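(* Let $n\ge3$ and let $F$ be a closed subset of $\mathbb{R}^n$ with the following property: there exists $r>0$ such that $$\mathrm{cap}(F\cap\bar B_r)\ge 0.01\,\mathrm{cap}(\bar B_r)$$ for all balls $B_r\subset\mathbb{R}^n$ of radius $r$. Then there exists $r_1>0$ such that $$\mathrm{cap}(F\cap\bar B_{r_1})\ge 0.99\,\mathrm{cap}(\bar B_{r_1})$$ for all balls $B_{r_1}\subset\mathbb{R}^n$ of radius $r_1$.
   Context: $B_r$ denotes an open ball of radius $r$ in $\mathbb{R}^n$ (with arbitrary center) and $\bar B_r$ its closure. The Wiener capacity of a compact set $K\subset\mathbb{R}^n$ is $$\mathrm{cap}(K)=\inf\left\{\int_{\mathbb{R}^n}|\nabla u|^2dx \;:\; u:\mathbb{R}^n\to\mathbb{R}\text{ Lipschitz with compact support},\ u|_K=1\right\}.$$ *)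

theory Defs
  imports "HOL-Analysis.Analysis"
begin

text \<open>A Lipschitz function is differentiable almost everywhere (Rademacher), so the value \<open>0\<close>
  at points of non-differentiability does not affect the Dirichlet integral below.\<close>

definition gradient :: "('a::euclidean_space \<Rightarrow> real) \<Rightarrow> 'a \<Rightarrow> 'a" where
  "gradient u x = (if \<exists>D. GDERIV u x :> D then THE D. GDERIV u x :> D else 0)"

lemma GDERIV_unique:
  fixes u :: "'a::euclidean_space \<Rightarrow> real"
  assumes "GDERIV u x :> D" "GDERIV u x :> E"
  shows "D = E"
proof -
  have "(\<lambda>h. h \<bullet> D) = (\<lambda>h. h \<bullet> E)"
    using assms unfolding gderiv_def by (rule has_derivative_unique)
  then show ?thesis
    by (metis vector_eq_ldot)
qed

lemma GDERIV_imp_gradient: "GDERIV u x :> D \<Longrightarrow> gradient u x = D"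
  unfolding gradient_def by (auto intro: the_equality GDERIV_unique)

text \<open>The infimum is taken in \<^typ>\<open>ennreal\<close>, where the Dirichlet integral needs no integrability
  proviso; for compact \<open>K\<close> it is finite.\<close>

definition wiener_capacity :: "'a::euclidean_space set \<Rightarrow> ennreal" where
  "wiener_capacity K =
     Inf {\<integral>\<^sup>+ x. ennreal ((norm (gradient u x))\<^sup>2) \<partial>lborel | u.
            (\<exists>C. C-lipschitz_on UNIV u) \<and> compact (closure {x. u x \<noteq> 0}) \<and> (\<forall>x\<in>K. u x = 1)}"

end

theory Submission
  imports Defs
begin

text \<open>Let \<open>u\<close> be a test function equal to \<open>1\<close> on \<open>F\<close> inside a ball of large radius \<open>R\<close>, with Dirichlet
  integral \<open>D\<close>. Around every point \<open>y\<close> of the concentric ball of radius \<open>R - r\<close>, the function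
  \<open>(u - u y) / (1 - u y)\<close> times a cutoff is a test function for \<open>F\<close> in the ball of radius \<open>r\<close> about \<open>y\<close>.
  The lower bound on that capacity bounds \<open>(1 - u y)\<^sup>2\<close> by local integrals of \<open>\<bar>u x - u y\<bar>\<^sup>2\<close> and
  \<open>\<bar>\<nabla>u\<bar>\<^sup>2\<close>; integrating over \<open>y\<close> bounds the integral of \<open>(1 - u)\<^sup>2\<close> by a multiple of \<open>D\<close> that
  depends on \<open>r\<close> but not on \<open>R\<close>. Cutting \<open>1 - u\<close> off over a layer of large but fixed width \<open>s\<close>
  therefore turns \<open>u\<close> into a test function for the full ball of radius \<open>R - r - s\<close> at the price of
  a factor close to \<open>1\<close>, and the capacities of the balls of radius \<open>R - r - s\<close> and \<open>R\<close> have a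
  ratio tending to \<open>1\<close>. If balls have capacity zero, there is nothing to prove.\<close>

section \<open>Rademacher's theorem\<close>

lemma continuous_on_complementary:
  fixes g1 g2 :: "real \<Rightarrow> real"
  assumes "mono g1" "mono g2" "\<And>x. g1 x + g2 x = x"
  shows "continuous_on UNIV g1"
proof -
  \<comment> \<open>Since \<open>g2\<close> increases as well, an increment of \<open>g1\<close>
    cannot exceed the increment of the identity.\<close>
  have "\<bar>g1 x - g1 y\<bar> \<le> 1 * \<bar>x - y\<bar>" for x y
    using monoD[OF assms(1), of x y] monoD[OF assms(1), of y x]
      monoD[OF assms(2), of x y] monoD[OF assms(2), of y x] assms(3)[of x] assms(3)[of y]
    by (cases "x \<le> y") auto
  then have "1-lipschitz_on UNIV g1"
    by (auto intro!: lipschitz_onI simp: dist_real_def)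
  then show ?thesis
    by (rule lipschitz_on_continuous_on)
qed

text \<open>Increments of \<open>g1\<close> and \<open>g2\<close> add up to interval lengths, so the
  sum of the two Stieltjes measures agrees with Lebesgue measure on open intervals and hence
  everywhere. In particular each of them is dominated by Lebesgue measure.\<close>

lemma interval_measure_complementary:
  fixes g1 g2 :: "real \<Rightarrow> real"
  assumes mono: "mono g1" "mono g2" and sum: "\<And>x. g1 x + g2 x = x" and A: "A \<in> sets borel"
  shows "emeasure (interval_measure g1) A + emeasure (interval_measure g2) A = emeasure lborel A"
proof -
  let ?m1 = "interval_measure g1" and ?m2 = "interval_measure g2"
  define M where "M = measure_of UNIV (sets borel) (\<lambda>A. emeasure ?m1 A + emeasure ?m2 A)"
  have sets_M: "sets M = sets (borel :: real measure)"
    unfolding M_def using sets.sets_measure_of_eq[of "borel :: real measure"] by simp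
  have M: "emeasure M B = emeasure ?m1 B + emeasure ?m2 B" if "B \<in> sets borel" for B
  proof (rule emeasure_measure_of[OF M_def])
    show "countably_additive (sets M) (\<lambda>A. emeasure ?m1 A + emeasure ?m2 A)"
      unfolding sets_M
      by (auto simp: countably_additive_def suminf_add[symmetric] intro!: suminf_emeasure arg_cong2[where f="(+)"])
  qed (use that in \<open>auto simp: positive_def sets_M\<close>)
  have cont: "continuous_on UNIV g1" "continuous_on UNIV g2"
    using continuous_on_complementary[of g1 g2] continuous_on_complementary[of g2 g1] assms
    by (auto simp: add.commute)
  have Icc: "emeasure (interval_measure g) {a..b} = ennreal (g b - g a)"
    if "mono g" "continuous_on UNIV g" "a \<le> b" for g :: "real \<Rightarrow> real" and a b
    using that by (intro emeasure_interval_measure_Icc) (auto simp: mono_def intro: continuous_on_subset)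
  \<comment> \<open>Continuity of \<open>g\<close> excludes atoms, so removing the endpoints changes
    nothing.\<close>
  have Ioo: "emeasure (interval_measure g) {a<..<b} = ennreal (g b - g a)"
    if g: "mono g" "continuous_on UNIV g" "a \<le> b" for g :: "real \<Rightarrow> real" and a b
  proof (cases "a = b")
    case False
    have *: "emeasure (interval_measure g) {c} = 0" for c
      using Icc[OF g(1,2), of c c] by simp
    have "{a..b} = {a<..<b} \<union> {a,b}"
      using g(3) False by auto
    then have "emeasure (interval_measure g) {a..b} = emeasure (interval_measure g) ({a<..<b} \<union> {a,b})"
      by (rule arg_cong)
    also have "\<dots> = emeasure (interval_measure g) {a<..<b}"
    proof (rule emeasure_Un_null_set)
      have "{a,b} = {a} \<union> {b}" by auto
      also have "\<dots> \<in> null_sets (interval_measure g)"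
        by (intro null_sets.Un) (auto simp: null_sets_def *)
      finally show "{a, b} \<in> null_sets (interval_measure g)" .
    qed auto
    finally show ?thesis
      using Icc[OF g] by simp
  qed auto
  have "lborel = M"
  proof (rule lborel_eqI)
    fix l u :: real
    assume "\<And>b. b \<in> Basis \<Longrightarrow> l \<bullet> b \<le> u \<bullet> b"
    then have lu: "l \<le> u" by simp
    have "emeasure M (box l u) = ennreal (g1 u - g1 l) + ennreal (g2 u - g2 l)"
      using Ioo[OF mono(1) cont(1) lu] Ioo[OF mono(2) cont(2) lu]
      by (simp add: M box_real)
    also have "\<dots> = ennreal (u - l)"
      using monoD[OF mono(1) lu] monoD[OF mono(2) lu] sum[of l] sum[of u]
      by (subst ennreal_plus[symmetric]) (auto simp: algebra_simps)
    finally show "emeasure M (box l u) = (\<Prod>b\<in>Basis. (u - l) \<bullet> b)"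
      by simp
  qed (rule sets_M)
  then show ?thesis
    using M[OF A] by simp
qed

text \<open>Having both \<open>g1\<close> and \<open>g2\<close> at hand makes the Stieltjes measure absolutely continuous, and it
  lets the same upper bound, applied to \<open>g2\<close>, serve as the lower bound for \<open>g1\<close>.\<close>

lemma interval_measure_le_slope:
  fixes g1 g2 :: "real \<Rightarrow> real"
  assumes mono: "mono g1" "mono g2" and sum: "\<And>x. g1 x + g2 x = x"
    and E: "E \<in> sets borel" and p: "0 \<le> p"
    and slope: "\<And>x d. x \<in> E \<Longrightarrow> 0 < d \<Longrightarrow>
      \<exists>a b. a < b \<and> a \<le> x \<and> x \<le> b \<and> b - a < d \<and> g1 b - g1 a \<le> p * (b - a)"
  shows "emeasure (interval_measure g1) E \<le> ennreal p * emeasure lborel E"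
proof -
  let ?m = "interval_measure g1"
  have cont: "continuous_on UNIV g1"
    using continuous_on_complementary[of g1 g2] assms by auto
  have main: "emeasure ?m E \<le> ennreal p * (emeasure lborel E + ennreal e)" if e: "e > 0" for e :: real
  proof -
    obtain U where U: "open U" "E \<subseteq> U" "emeasure lborel (U - E) < e"
      using outer_regular_lborel[OF E e] by blast
    \<comment> \<open>By the slope hypothesis, the intervals inside \<open>U\<close> on which
      \<open>g1\<close> has mean slope at most \<open>p\<close> cover \<open>E\<close> in the sense
      of Vitali. The family is indexed by endpoints, while the covering theorem wants centres
      \<open>m\<close> and radii \<open>r\<close>.\<close>
    define K where "K = {(a, b). a < b \<and> {a..b} \<subseteq> U \<and> g1 b - g1 a \<le> p * (b - a)}"
    define m r where "m = (\<lambda>(a::real, b). (a + b) / 2)" and "r = (\<lambda>(a::real, b). (b - a) / 2)"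
    have cb: "cball (m i) (r i) = {fst i..snd i}" for i
      by (auto simp: m_def r_def cball_eq_atLeastAtMost split: prod.splits) (auto simp: field_simps)
    obtain C where C: "countable C" "C \<subseteq> K"
      "pairwise (\<lambda>i j. disjnt (cball (m i) (r i)) (cball (m j) (r j))) C"
      "negligible (E - (\<Union>i \<in> C. cball (m i) (r i)))"
    proof (rule Vitali_covering_theorem_cballs[of K r E m])
      show "0 < r i" if "i \<in> K" for i
        using that by (auto simp: K_def r_def)
      fix x d :: real assume x: "x \<in> E" "0 < d"
      with U obtain e where e: "0 < e" "ball x e \<subseteq> U"
        using open_contains_ball by blast
      obtain a b where ab: "a < b" "a \<le> x" "x \<le> b" "b - a < min d e" "g1 b - g1 a \<le> p * (b - a)"
        using slope[OF x(1), of "min d e"] x(2) e(1) by auto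
      have "{a..b} \<subseteq> ball x e"
        using ab by (auto simp: dist_real_def)
      then have "(a, b) \<in> K"
        using ab e(2) unfolding K_def by blast
      then show "\<exists>i. i \<in> K \<and> x \<in> cball (m i) (r i) \<and> r i < d"
        using ab by (intro exI[of _ "(a, b)"]) (auto simp del: mem_cball simp: cb, auto simp: r_def field_simps)
    qed
    let ?I = "\<lambda>i::real \<times> real. {fst i..snd i}"
    have dis: "disjoint_family_on ?I C"
      using C(3) unfolding cb by (auto simp: disjoint_family_on_def pairwise_def disjnt_def)
    have UN: "(\<Union>i\<in>C. ?I i) \<in> sets borel"
      using C(1) by (intro sets.countable_UN') auto
    \<comment> \<open>Vitali leaves a remainder of Lebesgue measure zero; domination by Lebesgue
      measure makes it null for \<open>g1\<close> too. This is where a singular part of the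
      Stieltjes measure would spoil the bound.\<close>
    have "emeasure ?m (E - (\<Union>i\<in>C. ?I i)) = 0"
    proof -
      have "E - (\<Union>i\<in>C. ?I i) \<in> sets borel"
        using E UN by auto
      moreover from this have "emeasure lborel (E - (\<Union>i\<in>C. ?I i)) = 0"
        using C(4) unfolding cb negligible_iff_null_sets by (auto simp: null_sets_def)
      ultimately show ?thesis
        using interval_measure_complementary[OF mono sum, of "E - (\<Union>i\<in>C. ?I i)"] by (auto simp: add_eq_0_iff_both_eq_0)
    qed
    then have null: "E - (\<Union>i\<in>C. ?I i) \<in> null_sets ?m"
      using E UN by (auto simp: null_sets_def)
    have "emeasure ?m E \<le> emeasure ?m ((\<Union>i\<in>C. ?I i) \<union> (E - (\<Union>i\<in>C. ?I i)))"
      using E UN by (intro emeasure_mono) auto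
    also have "\<dots> = emeasure ?m (\<Union>i\<in>C. ?I i)"
      using UN null by (intro emeasure_Un_null_set) auto
    also have "\<dots> = (\<integral>\<^sup>+ i. emeasure ?m (?I i) \<partial>count_space C)"
      using C(1) dis by (intro emeasure_UN_countable) auto
    also have "\<dots> \<le> (\<integral>\<^sup>+ i. ennreal p * emeasure lborel (?I i) \<partial>count_space C)"
    proof (rule nn_integral_mono)
      fix i assume "i \<in> space (count_space C)"
      with C(2) have i: "fst i < snd i" "g1 (snd i) - g1 (fst i) \<le> p * (snd i - fst i)"
        by (auto simp: K_def)
      have "emeasure ?m (?I i) = ennreal (g1 (snd i) - g1 (fst i))"
        using mono cont i by (intro emeasure_interval_measure_Icc) (auto simp: mono_def intro: continuous_on_subset)
      also have "\<dots> \<le> ennreal (p * (snd i - fst i))"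
        using i by (intro ennreal_leI) auto
      also have "\<dots> = ennreal p * emeasure lborel (?I i)"
        using i p by (simp add: ennreal_mult)
      finally show "emeasure ?m (?I i) \<le> ennreal p * emeasure lborel (?I i)" .
    qed
    also have "\<dots> = ennreal p * (\<integral>\<^sup>+ i. emeasure lborel (?I i) \<partial>count_space C)"
      by (intro nn_integral_cmult) auto
    also have "(\<integral>\<^sup>+ i. emeasure lborel (?I i) \<partial>count_space C) = emeasure lborel (\<Union>i\<in>C. ?I i)"
      using C(1) dis by (intro emeasure_UN_countable[symmetric]) auto
    also have "\<dots> \<le> emeasure lborel (E \<union> (U - E))"
      using C(2) U E by (intro emeasure_mono) (fastforce simp: K_def)+
    also have "\<dots> \<le> emeasure lborel E + emeasure lborel (U - E)"
      using E U by (intro emeasure_subadditive) auto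
    also have "\<dots> \<le> emeasure lborel E + ennreal e"
      using U by (intro add_left_mono) auto
    finally show ?thesis
      by (simp add: mult_left_mono)
  qed
  show ?thesis
  proof (rule ennreal_le_epsilon)
    fix e :: real assume e: "0 < e"
    \<comment> \<open>Dividing by \<open>p + 1\<close> instead of \<open>p\<close> includes the case
      \<open>p = 0\<close>.\<close>
    have "emeasure ?m E \<le> ennreal p * (emeasure lborel E + ennreal (e / (p + 1)))"
      using e p by (intro main) auto
    also have "\<dots> = ennreal p * emeasure lborel E + ennreal (p * (e / (p + 1)))"
      using e p by (subst ennreal_mult) (auto simp: distrib_left)
    also have "\<dots> \<le> ennreal p * emeasure lborel E + ennreal e"
      using e p by (intro add_left_mono ennreal_leI) (auto simp: field_simps)
    finally show "emeasure ?m E \<le> ennreal p * emeasure lborel E + ennreal e" .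
  qed
qed

section \<open>Points where difference quotients oscillate\<close>

definition oscillation_set :: "('a::real_normed_vector \<Rightarrow> real) \<Rightarrow> 'a \<Rightarrow> real \<Rightarrow> real \<Rightarrow> 'a set" where
  "oscillation_set u v p q =
     {x. \<forall>n::nat. (\<exists>h. h \<noteq> 0 \<and> \<bar>h\<bar> < 1 / Suc n \<and> (u (x + h *\<^sub>R v) - u x) / h < p) \<and>
                  (\<exists>h. h \<noteq> 0 \<and> \<bar>h\<bar> < 1 / Suc n \<and> q < (u (x + h *\<^sub>R v) - u x) / h)}"

text \<open>For a fixed increment \<open>h\<close> each condition is open, so the uncountable unions
  over \<open>h\<close> remain open; only the intersection over \<open>n\<close> has to be
  countable.\<close>

lemma oscillation_set_borel:
  assumes "continuous_on UNIV u"
  shows "oscillation_set u v p q \<in> sets borel"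
proof -
  have c: "continuous_on UNIV (\<lambda>x. (u (x + h *\<^sub>R v) - u x) / h)" if "h \<noteq> 0" for h
    using that by (intro continuous_intros continuous_on_compose2[OF assms]) auto
  have "oscillation_set u v p q =
    (\<Inter>n::nat. (\<Union>h\<in>{h. h \<noteq> 0 \<and> \<bar>h\<bar> < 1 / Suc n}. {x. (u (x + h *\<^sub>R v) - u x) / h < p}) \<inter>
       (\<Union>h\<in>{h. h \<noteq> 0 \<and> \<bar>h\<bar> < 1 / Suc n}. {x. q < (u (x + h *\<^sub>R v) - u x) / h}))"
    unfolding oscillation_set_def by blast
  also have "\<dots> \<in> sets borel"
    by (intro sets.countable_INT'' borel_open open_Int open_UN ballI open_Collect_less c continuous_on_const) auto
  finally show ?thesis .
qed

text \<open>Increments of either sign become intervals with \<open>x\<close> as an endpoint. The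
  choice of \<open>a\<close> and \<open>b\<close> does not depend on \<open>g\<close>, so it serves
  a function and its complement alike.\<close>

lemma interval_of_increment:
  fixes h x y :: real
  assumes "h \<noteq> 0" "\<bar>h\<bar> < d"
  obtains a b where "a < b" "a \<le> x" "x \<le> b" "b - a < d"
    "\<And>g :: real \<Rightarrow> real. (g (x + h) - g x) / h = (g b - g a) / (b - a)"
proof (cases "h > 0")
  case True
  then show ?thesis
    using assms by (intro that[of x "x + h"]) auto
next
  case False
  have "(g (x + h) - g x) / h = (g x - g (x + h)) / (x - (x + h))" for g :: "real \<Rightarrow> real"
    using assms False by (simp add: field_simps)
  then show ?thesis
    using assms False by (intro that[of "x + h" x]) auto
qed

text \<open>On a bounded piece \<open>?F\<close> of the set, small intervals with slope of
  \<open>g1\<close> below \<open>p'\<close> bound its \<open>g1\<close>-measure by \<open>p'\<close>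
  times the length of \<open>?F\<close>, and intervals with slope of \<open>g1\<close> above
  \<open>q'\<close> bound its \<open>g2\<close>-measure by \<open>1 - q'\<close> times that length.
  The two measures add up to Lebesgue measure, and \<open>p' + (1 - q') < 1\<close>, so the length
  is zero.\<close>

lemma oscillation_set_real_null:
  fixes g :: "real \<Rightarrow> real"
  assumes g: "C-lipschitz_on UNIV g" and "p < q"
  shows "oscillation_set g 1 p q \<in> null_sets lborel"
proof -
  \<comment> \<open>The maximum keeps \<open>L\<close> positive even when
    \<open>C = 0\<close>.\<close>
  define L where "L = max C 1"
  have L: "L > 0" and gL: "\<bar>g x - g y\<bar> \<le> L * \<bar>x - y\<bar>" for x y
  proof -
    have "\<bar>g x - g y\<bar> \<le> C * \<bar>x - y\<bar>"
      using lipschitz_onD[OF g, of x y] by (simp add: dist_real_def)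
    also have "\<dots> \<le> L * \<bar>x - y\<bar>"
      by (intro mult_right_mono) (auto simp: L_def)
    finally show "\<bar>g x - g y\<bar> \<le> L * \<bar>x - y\<bar>" .
  qed (auto simp: L_def)
  \<comment> \<open>The term \<open>g / (2 * L)\<close> changes at rate at most
    \<open>1 / 2\<close>, so adding it to or subtracting it from \<open>x / 2\<close> leaves an
    increasing function.\<close>
  define g1 g2 where "g1 = (\<lambda>x. x / 2 + g x / (2 * L))" and "g2 = (\<lambda>x. x / 2 - g x / (2 * L))"
  have sum: "g1 x + g2 x = x" "g2 x + g1 x = x" for x
    by (auto simp: g1_def g2_def)
  have mono: "mono g1" "mono g2"
  proof -
    have "g1 x \<le> g1 y \<and> g2 x \<le> g2 y" if "x \<le> y" for x y
    proof -
      have "\<bar>(g x - g y) / (2 * L)\<bar> \<le> (y - x) / 2"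
        using gL[of x y] that L by (auto simp: field_simps abs_if split: if_splits)
      then have "\<bar>g x / (2 * L) - g y / (2 * L)\<bar> \<le> y / 2 - x / 2"
        by (simp add: diff_divide_distrib)
      then show ?thesis
        unfolding g1_def g2_def by linarith
    qed
    then show "mono g1" "mono g2" by (auto simp: mono_def)
  qed
  define p' q' where "p' = 1 / 2 + p / (2 * L)" and "q' = 1 / 2 + q / (2 * L)"
  have pq': "p' < q'"
    using \<open>p < q\<close> L by (auto simp: p'_def q'_def divide_strict_right_mono)
  let ?E = "oscillation_set g 1 p q"
  have cont: "continuous_on UNIV g"
    using g by (rule lipschitz_on_continuous_on)
  \<comment> \<open>Localising makes the measure finite, so that it can be cancelled at the
    end.\<close>
  have bounded_part: "?E \<inter> ball 0 (real k) \<in> null_sets lborel" for k :: nat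
  proof -
    let ?F = "?E \<inter> ball 0 (real k)"
    have F: "?F \<in> sets borel"
      using oscillation_set_borel[OF cont] by auto
    have fin: "emeasure lborel ?F < \<infinity>"
      by (intro emeasure_bounded_finite bounded_subset[OF bounded_ball[of 0 "real k"]]) auto
    have low: "\<exists>a b. a < b \<and> a \<le> x \<and> x \<le> b \<and> b - a < d \<and> g1 b - g1 a < p' * (b - a)"
      if x: "x \<in> ?E" and d: "0 < d" for x d
    proof -
      obtain n :: nat where n: "1 / Suc n < d"
        using d nat_approx_posE by blast
      obtain h where h: "h \<noteq> 0" "\<bar>h\<bar> < 1 / Suc n" "(g (x + h) - g x) / h < p"
        using x unfolding oscillation_set_def by auto
      obtain a b where ab: "a < b" "a \<le> x" "x \<le> b" "b - a < d"
        "(g (x + h) - g x) / h = (g b - g a) / (b - a)"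
        using interval_of_increment[of h d x] h n by (metis order_less_trans)
      then have "(g b - g a) / (b - a) < p"
        using h by simp
      then have "g b - g a < p * (b - a)"
        using ab(1) by (simp add: pos_divide_less_eq)
      then have "(g b - g a) / (2 * L) < p * (b - a) / (2 * L)"
        using L by (intro divide_strict_right_mono) auto
      then have "g1 b - g1 a < p' * (b - a)"
        by (simp add: g1_def p'_def algebra_simps diff_divide_distrib add_divide_distrib)
      with ab show ?thesis by blast
    qed
    have high: "\<exists>a b. a < b \<and> a \<le> x \<and> x \<le> b \<and> b - a < d \<and> g2 b - g2 a < (1 - q') * (b - a)"
      if x: "x \<in> ?E" and d: "0 < d" for x d
    proof -
      obtain n :: nat where n: "1 / Suc n < d"
        using d nat_approx_posE by blast
      obtain h where h: "h \<noteq> 0" "\<bar>h\<bar> < 1 / Suc n" "q < (g (x + h) - g x) / h"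
        using x unfolding oscillation_set_def by auto
      obtain a b where ab: "a < b" "a \<le> x" "x \<le> b" "b - a < d"
        "(g (x + h) - g x) / h = (g b - g a) / (b - a)"
        using interval_of_increment[of h d x] h n by (metis order_less_trans)
      then have "q < (g b - g a) / (b - a)"
        using h by simp
      then have "q * (b - a) < g b - g a"
        using ab(1) by (simp add: pos_less_divide_eq)
      then have "q * (b - a) / (2 * L) < (g b - g a) / (2 * L)"
        using L by (intro divide_strict_right_mono) auto
      then have "g2 b - g2 a < (1 - q') * (b - a)"
        by (simp add: g2_def q'_def algebra_simps diff_divide_distrib add_divide_distrib)
      with ab show ?thesis by blast
    qed
    show ?thesis
    proof (cases "?E = {}")
      case False
      then obtain x where x: "x \<in> ?E" by blast
      \<comment> \<open>A single point of the set suffices: an increasing function has some mean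
        slope below \<open>p'\<close>.\<close>
      have p0: "0 \<le> p'"
      proof -
        obtain a b where "a < b" "g1 b - g1 a < p' * (b - a)"
          using low[OF x, of 1] by auto
        then have "0 < p' * (b - a)" "0 < b - a"
          using monoD[OF mono(1), of a b] by linarith+
        then show ?thesis by (simp add: zero_less_mult_iff)
      qed
      have q0: "0 \<le> 1 - q'"
      proof -
        obtain a b where "a < b" "g2 b - g2 a < (1 - q') * (b - a)"
          using high[OF x, of 1] by auto
        then have "0 < (1 - q') * (b - a)" "0 < b - a"
          using monoD[OF mono(2), of a b] by linarith+
        then show ?thesis by (simp add: zero_less_mult_iff)
      qed
      have "emeasure (interval_measure g1) ?F \<le> ennreal p' * emeasure lborel ?F"
        by (rule interval_measure_le_slope[OF mono sum(1) F p0]) (meson IntD1 low less_imp_le)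
      moreover have "emeasure (interval_measure g2) ?F \<le> ennreal (1 - q') * emeasure lborel ?F"
        by (rule interval_measure_le_slope[OF mono(2,1) sum(2) F q0]) (meson IntD1 high less_imp_le)
      ultimately have "emeasure lborel ?F \<le> ennreal p' * emeasure lborel ?F + ennreal (1 - q') * emeasure lborel ?F"
        unfolding interval_measure_complementary[OF mono sum(1) F, symmetric] by (rule add_mono)
      also have "\<dots> = ennreal (p' + (1 - q')) * emeasure lborel ?F"
        using p0 q0 by (simp add: distrib_right)
      finally have le: "emeasure lborel ?F \<le> ennreal (p' + (1 - q')) * emeasure lborel ?F" .
      obtain m where m: "m \<ge> 0" "emeasure lborel ?F = ennreal m"
        using fin by (cases "emeasure lborel ?F") auto
      have "m \<le> (p' + (1 - q')) * m"
      proof -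
        have "ennreal m \<le> ennreal ((p' + (1 - q')) * m)"
          using le m p0 q0 by (subst ennreal_mult) auto
        then show ?thesis
          using m p0 q0 by (subst (asm) ennreal_le_iff) auto
      qed
      then have "(q' - p') * m \<le> 0"
        by (simp add: algebra_simps)
      then have "m = 0"
        using pq' m by (simp add: mult_le_0_iff)
      then show ?thesis
        using F m by (auto simp: null_sets_def)
    qed auto
  qed
  have "?E = (\<Union>k. ?E \<inter> ball 0 (real k))"
    using reals_Archimedean2 by (auto simp: dist_real_def)
  also have "\<dots> \<in> null_sets lborel"
    using bounded_part by (intro null_sets_UN) auto
  finally show ?thesis .
qed

section \<open>Affine substitutions and null sets along lines\<close>

lemma nn_integral_lborel_affine:
  fixes f :: "'a::euclidean_space \<Rightarrow> ennreal"
  assumes [measurable]: "f \<in> borel_measurable borel" and c: "c \<noteq> 0"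
  shows "(\<integral>\<^sup>+x. f x \<partial>lborel) = ennreal (\<bar>c\<bar> ^ DIM('a)) * (\<integral>\<^sup>+x. f (a + c *\<^sub>R x) \<partial>lborel)"
proof -
  have "(\<integral>\<^sup>+x. f x \<partial>lborel)
    = (\<integral>\<^sup>+x. f x \<partial>density (distr lborel borel (\<lambda>x. a + c *\<^sub>R x)) (\<lambda>_. \<bar>c\<bar> ^ DIM('a)))"
    using lborel_affine[OF c, of a] by simp
  also have "\<dots> = (\<integral>\<^sup>+x. ennreal (\<bar>c\<bar> ^ DIM('a)) * f (a + c *\<^sub>R x) \<partial>lborel)"
    by (subst nn_integral_density, simp, simp, subst nn_integral_distr) auto
  finally show ?thesis
    by (simp add: nn_integral_cmult)
qed

lemma nn_integral_lborel_translate: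
  fixes f :: "'a::euclidean_space \<Rightarrow> ennreal"
  assumes "f \<in> borel_measurable borel"
  shows "(\<integral>\<^sup>+x. f (x + a) \<partial>lborel) = (\<integral>\<^sup>+x. f x \<partial>lborel)"
  using nn_integral_lborel_affine[OF assms, of 1 a] by (simp add: add.commute)

lemma AE_lborel_affine:
  fixes a :: "'a::euclidean_space"
  assumes "AE x in lborel. P x" and c: "c \<noteq> 0"
  shows "AE x in lborel. P (a + c *\<^sub>R x)"
proof -
  obtain N where N: "{x. \<not> P x} \<subseteq> N" "emeasure lborel N = 0" "N \<in> sets borel"
    using AE_E[OF assms(1)] by auto
  have "(\<integral>\<^sup>+x. indicator N (a + c *\<^sub>R x) \<partial>lborel) = (0::ennreal)"
    using nn_integral_lborel_affine[of "indicator N" c a] N c by simp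
  then have "AE x in lborel. indicator N (a + c *\<^sub>R x) = (0::ennreal)"
    using N(3) by (subst (asm) nn_integral_0_iff_AE) auto
  then show ?thesis
    by eventually_elim (use N(1) in \<open>auto simp: indicator_def split: if_splits\<close>)
qed

text \<open>Instead of rotating coordinates, all translates of \<open>B\<close> by
  \<open>t *\<^sub>R v\<close> with \<open>t\<close> in the unit interval are averaged. Each has the
  measure of \<open>B\<close>, while Fubini evaluates the average first along lines, where it
  vanishes.\<close>

lemma null_set_if_null_on_lines:
  fixes B :: "'a::euclidean_space set"
  assumes B[measurable]: "B \<in> sets borel"
    and lines: "\<And>x. {t::real. x + t *\<^sub>R v \<in> B} \<in> null_sets lborel"
  shows "B \<in> null_sets lborel"
proof -
  let ?f = "\<lambda>(x::'a) t::real. indicator B (x + t *\<^sub>R v) * indicator {0..1} t :: ennreal"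
  have "emeasure lborel B = (\<integral>\<^sup>+t. emeasure lborel B * indicator {0..1::real} t \<partial>lborel)"
    by (subst nn_integral_cmult_indicator) auto
  also have "\<dots> = (\<integral>\<^sup>+t. (\<integral>\<^sup>+x. ?f x t \<partial>lborel) \<partial>lborel)"
  proof (intro nn_integral_cong)
    fix t :: real
    have "(\<integral>\<^sup>+x. ?f x t \<partial>lborel) = (\<integral>\<^sup>+x. indicator B (x + t *\<^sub>R v) \<partial>lborel) * indicator {0..1} t"
      by (intro nn_integral_multc) auto
    then show "emeasure lborel B * indicator {0..1::real} t = (\<integral>\<^sup>+x. ?f x t \<partial>lborel)"
      by (simp add: nn_integral_lborel_translate[of "indicator B"])
  qed
  also have "\<dots> = (\<integral>\<^sup>+x. (\<integral>\<^sup>+t. ?f x t \<partial>lborel) \<partial>lborel)"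
    by (intro lborel_pair.Fubini') auto
  also have "\<dots> = (\<integral>\<^sup>+x. 0 \<partial>(lborel::'a measure))"
  proof (intro nn_integral_cong)
    fix x :: 'a
    have "(\<integral>\<^sup>+t. ?f x t \<partial>lborel) \<le> (\<integral>\<^sup>+t. indicator {t. x + t *\<^sub>R v \<in> B} t \<partial>lborel)"
      by (intro nn_integral_mono) (auto simp: indicator_def)
    also have "\<dots> = 0"
      using lines[of x] by (subst nn_integral_indicator) (auto simp: null_sets_def)
    finally show "(\<integral>\<^sup>+t. ?f x t \<partial>lborel) = 0" by simp
  qed
  finally show ?thesis
    using B by (auto simp: null_sets_def)
qed

section \<open>Directional derivatives of Lipschitz functions\<close>

definition has_dir_deriv :: "('a::real_normed_vector \<Rightarrow> real) \<Rightarrow> 'a \<Rightarrow> 'a \<Rightarrow> real \<Rightarrow> bool" where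
  "has_dir_deriv u v x D \<longleftrightarrow> ((\<lambda>h. (u (x + h *\<^sub>R v) - u x) / h) \<longlongrightarrow> D) (at 0)"

text \<open>The limit along one fixed sequence gives a total function that is Borel for continuous
  \<open>u\<close>; where the two-sided limit exists, it has the same value.\<close>

definition dir_deriv :: "('a::real_normed_vector \<Rightarrow> real) \<Rightarrow> 'a \<Rightarrow> 'a \<Rightarrow> real" where
  "dir_deriv u v x = lim (\<lambda>n. (u (x + (1 / real (Suc n)) *\<^sub>R v) - u x) / (1 / real (Suc n)))"

lemma inverse_Suc_at_0: "filterlim (\<lambda>n. 1 / real (Suc n)) (at 0) sequentially"
  unfolding filterlim_at using LIMSEQ_inverse_real_of_nat by (auto simp: inverse_eq_divide)

lemma has_dir_deriv_LIMSEQ: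
  assumes "has_dir_deriv u v x D"
  shows "(\<lambda>n. (u (x + (1 / real (Suc n)) *\<^sub>R v) - u x) / (1 / real (Suc n))) \<longlonglongrightarrow> D"
  using filterlim_compose[OF assms[unfolded has_dir_deriv_def] inverse_Suc_at_0] by simp

lemma has_dir_deriv_eq: "has_dir_deriv u v x D \<Longrightarrow> dir_deriv u v x = D"
  unfolding dir_deriv_def by (intro limI has_dir_deriv_LIMSEQ)

lemma dir_deriv_borel:
  assumes "continuous_on UNIV u"
  shows "dir_deriv u v \<in> borel_measurable borel"
proof -
  have "continuous_on UNIV (\<lambda>x. u (x + c *\<^sub>R v))" for c
    by (intro continuous_on_compose2[OF assms]) (auto intro!: continuous_intros)
  from this[THEN borel_measurable_continuous_onI] assms[THEN borel_measurable_continuous_onI]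
  show ?thesis
    unfolding dir_deriv_def[abs_def]
    by (intro borel_measurable_lim_metric borel_measurable_divide borel_measurable_diff) auto
qed

lemma has_dir_deriv_scaleR:
  assumes "has_dir_deriv u v x D"
  shows "has_dir_deriv u (c *\<^sub>R v) x (c * D)"
proof (cases "c = 0")
  case True
  then show ?thesis by (simp add: has_dir_deriv_def)
next
  case False
  have "filterlim (\<lambda>h. h * c) (at 0) (at 0)"
    unfolding filterlim_at using False by (auto intro!: tendsto_eq_intros eventually_at_filter[THEN iffD2])
  then have "((\<lambda>h. (u (x + (h * c) *\<^sub>R v) - u x) / (h * c)) \<longlongrightarrow> D) (at 0)"
    by (rule filterlim_compose[OF assms[unfolded has_dir_deriv_def]])
  then have "((\<lambda>h. c * ((u (x + (h * c) *\<^sub>R v) - u x) / (h * c))) \<longlongrightarrow> c * D) (at 0)"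
    by (intro tendsto_intros)
  then show ?thesis
    using False by (simp add: has_dir_deriv_def)
qed

lemma has_dir_deriv_GDERIV:
  fixes u :: "'a::euclidean_space \<Rightarrow> real"
  assumes "GDERIV u x :> D"
  shows "has_dir_deriv u v x (v \<bullet> D)"
proof -
  have "((\<lambda>t::real. x + t *\<^sub>R v) has_derivative (\<lambda>t. t *\<^sub>R v)) (at 0)"
    by (auto intro!: derivative_eq_intros)
  moreover have "(u has_derivative (\<lambda>h. h \<bullet> D)) (at (x + 0 *\<^sub>R v))"
    using assms by (simp add: gderiv_def)
  ultimately have "((\<lambda>t. u (x + t *\<^sub>R v)) has_derivative (\<lambda>t. (t *\<^sub>R v) \<bullet> D)) (at 0)"
    by (rule has_derivative_compose)
  then have "((\<lambda>t. u (x + t *\<^sub>R v)) has_field_derivative (v \<bullet> D)) (at 0)"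
    unfolding has_field_derivative_def by (rule has_derivative_eq_rhs) (auto simp: fun_eq_iff)
  then show ?thesis
    by (simp add: has_dir_deriv_def DERIV_def)
qed

lemma lipschitz_dq_bound:
  fixes u :: "'a::real_normed_vector \<Rightarrow> real"
  assumes "C-lipschitz_on UNIV u"
  shows "\<bar>(u (x + h *\<^sub>R v) - u x) / h\<bar> \<le> C * norm v"
proof (cases "h = 0")
  case True
  then show ?thesis
    using lipschitz_on_nonneg[OF assms] by simp
next
  case False
  have "\<bar>u (x + h *\<^sub>R v) - u x\<bar> \<le> C * (\<bar>h\<bar> * norm v)"
    using lipschitz_onD[OF assms, of "x + h *\<^sub>R v" x] by (simp add: dist_norm)
  then show ?thesis
    using False by (simp add: divide_le_eq abs_divide mult_ac)
qed

lemma has_dir_deriv_bound: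
  fixes u :: "'a::real_normed_vector \<Rightarrow> real"
  assumes "C-lipschitz_on UNIV u" "has_dir_deriv u v x D"
  shows "\<bar>D\<bar> \<le> C * norm v"
proof -
  have "(\<lambda>n. \<bar>(u (x + (1 / real (Suc n)) *\<^sub>R v) - u x) / (1 / real (Suc n))\<bar>) \<longlonglongrightarrow> \<bar>D\<bar>"
    by (intro tendsto_rabs has_dir_deriv_LIMSEQ assms)
  then show ?thesis
    by (rule LIMSEQ_le_const2) (use lipschitz_dq_bound[OF assms(1)] in blast)
qed

lemma GDERIV_lipschitz_bound:
  fixes u :: "'a::euclidean_space \<Rightarrow> real"
  assumes "C-lipschitz_on UNIV u" "GDERIV u x :> D"
  shows "norm D \<le> C"
proof -
  have "norm D * norm D \<le> C * norm D"
    using has_dir_deriv_bound[OF assms(1) has_dir_deriv_GDERIV[OF assms(2), of D]]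
    by (simp add: power2_norm_eq_inner[symmetric] power2_eq_square)
  then show ?thesis
    using lipschitz_on_nonneg[OF assms(1)] by (cases "D = 0") auto
qed

text \<open>The Lipschitz bound makes the lower and upper limits of the quotients finite. If they
  differed, two rationals strictly between them would put \<open>x\<close> into an oscillation
  set.\<close>

lemma has_dir_deriv_if_no_oscillation:
  fixes u :: "'a::euclidean_space \<Rightarrow> real"
  assumes u: "C-lipschitz_on UNIV u"
    and x: "\<And>p q. p \<in> \<rat> \<Longrightarrow> q \<in> \<rat> \<Longrightarrow> p < q \<Longrightarrow> x \<notin> oscillation_set u v p q"
  shows "has_dir_deriv u v x (dir_deriv u v x)"
proof -
  define f where "f = (\<lambda>h. (u (x + h *\<^sub>R v) - u x) / h)"
  define B where "B = C * norm v"
  have B: "f h \<le> B" "- B \<le> f h" for h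
    using lipschitz_dq_bound[OF u, of x h v] unfolding f_def B_def abs_le_iff by auto
  let ?l = "Liminf (at 0) (\<lambda>h. ereal (f h))" and ?s = "Limsup (at 0) (\<lambda>h. ereal (f h))"
  have freq: "\<exists>h. h \<noteq> 0 \<and> \<bar>h\<bar> < 1 / Suc n \<and> P h" if "\<exists>\<^sub>F h in at (0::real). P h" for P and n :: nat
    using that unfolding frequently_at by (auto simp: dist_real_def dest!: spec[of _ "1 / real (Suc n)"])
  have "\<not> ?l < ?s"
  proof
    assume "?l < ?s"
    then obtain p where p: "?l < real_of_rat p" "real_of_rat p < ?s"
      using ereal_dense3 by blast
    then obtain q where q: "real_of_rat p < ereal (real_of_rat q)" "real_of_rat q < ?s"
      using ereal_dense3 by blast
    have "\<exists>\<^sub>F h in at 0. f h < real_of_rat p"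
    proof (rule ccontr)
      assume "\<not> ?thesis"
      then have "\<forall>\<^sub>F h in at 0. ereal (real_of_rat p) \<le> ereal (f h)"
        by (simp add: not_frequently not_less)
      from Liminf_bounded[OF this] p(1) show False by simp
    qed
    moreover have "\<exists>\<^sub>F h in at 0. real_of_rat q < f h"
    proof (rule ccontr)
      assume "\<not> ?thesis"
      then have "\<forall>\<^sub>F h in at 0. ereal (f h) \<le> ereal (real_of_rat q)"
        by (simp add: not_frequently not_less)
      from Limsup_bounded[OF this] q(2) show False by simp
    qed
    ultimately have "x \<in> oscillation_set u v (real_of_rat p) (real_of_rat q)"
      unfolding oscillation_set_def f_def using freq by blast
    with x[of "real_of_rat p" "real_of_rat q"] q show False by simp
  qed
  moreover have "?l \<le> ?s"
    by (intro Liminf_le_Limsup) simp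
  ultimately have eq: "?l = ?s" by simp
  have "ereal (- B) \<le> ?l" "?s \<le> ereal B"
    using B by (auto intro!: Liminf_bounded Limsup_bounded)
  then have "ereal (- B) \<le> ?l" "?l \<le> ereal B"
    by (simp_all only: eq)
  then obtain D where D: "?l = ereal D"
    by (cases ?l) auto
  have "((\<lambda>h. ereal (f h)) \<longlongrightarrow> ereal D) (at 0)"
    using D eq by (intro Liminf_eq_Limsup) auto
  then have "has_dir_deriv u v x D"
    by (simp add: has_dir_deriv_def f_def)
  with has_dir_deriv_eq[OF this] show ?thesis by simp
qed

text \<open>On a line in direction \<open>v\<close> the oscillation set is that of a Lipschitz
  function of one variable, hence null; Fubini and the countably many rational pairs do the
  rest.\<close>

lemma AE_has_dir_deriv:
  fixes u :: "'a::euclidean_space \<Rightarrow> real"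
  assumes u: "C-lipschitz_on UNIV u"
  shows "AE x in lborel. has_dir_deriv u v x (dir_deriv u v x)"
proof -
  have null: "oscillation_set u v p q \<in> null_sets lborel" if "p < q" for p q
  proof (rule null_set_if_null_on_lines)
    show "oscillation_set u v p q \<in> sets borel"
      by (intro oscillation_set_borel lipschitz_on_continuous_on[OF u])
    fix x
    have "(C * norm v)-lipschitz_on UNIV (\<lambda>t. u (x + t *\<^sub>R v))"
    proof (rule lipschitz_onI)
      show "dist (u (x + s *\<^sub>R v)) (u (x + t *\<^sub>R v)) \<le> C * norm v * dist s t" for s t
        using lipschitz_onD[OF u, of "x + s *\<^sub>R v" "x + t *\<^sub>R v"]
        by (simp add: dist_norm scaleR_diff_left[symmetric] mult_ac)
    qed (use lipschitz_on_nonneg[OF u] in auto)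
    from oscillation_set_real_null[OF this that]
    show "{t. x + t *\<^sub>R v \<in> oscillation_set u v p q} \<in> null_sets lborel"
      unfolding oscillation_set_def by (simp add: scaleR_add_left add.assoc)
  qed
  have "AE x in lborel. \<forall>(p, q) \<in> {(p, q). p \<in> \<rat> \<and> q \<in> \<rat> \<and> p < q}. x \<notin> oscillation_set u v p q"
  proof (subst AE_ball_countable)
    show "countable {(p, q). p \<in> \<rat> \<and> q \<in> \<rat> \<and> p < (q::real)}"
      by (rule countable_subset[of _ "\<rat> \<times> \<rat>"]) (auto intro: countable_rat)
    show "\<forall>pq\<in>{(p, q). p \<in> \<rat> \<and> q \<in> \<rat> \<and> p < (q::real)}.
        AE x in lborel. case pq of (p, q) \<Rightarrow> x \<notin> oscillation_set u v p q"
      by (auto intro!: AE_not_in null)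
  qed
  then show ?thesis
    by eventually_elim (auto intro!: has_dir_deriv_if_no_oscillation[OF u])
qed

section \<open>Linearity in the direction, and total differentiability\<close>

lemma AE_zero_if_box_integrals_zero:
  fixes w :: "'a::euclidean_space \<Rightarrow> real"
  assumes w[measurable]: "w \<in> borel_measurable borel" and M: "AE x in lborel. \<bar>w x\<bar> \<le> M"
    and zero: "\<And>a b. (LINT x|lborel. indicator (box a b) x * w x) = 0"
  shows "AE x in lborel. w x = 0"
proof -
  \<comment> \<open>Adding \<open>c\<close> makes \<open>w\<close> nonnegative almost everywhere, so
    that \<open>w + c\<close> and \<open>c\<close> are densities of measures. These agree on boxes,
    which are stable under intersection and generate the Borel sets, and uniqueness of densities
    gives \<open>w = 0\<close>.\<close>
  define c where "c = max M 0"
  have c: "c \<ge> 0" and wc: "AE x in lborel. \<bar>w x\<bar> \<le> c"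
    using M unfolding c_def by auto
  have fin: "emeasure lborel (box a b) < \<infinity>" for a b :: 'a
    by (intro emeasure_bounded_finite bounded_box)
  have indI: "integrable lborel (indicator (box a b) :: 'a \<Rightarrow> real)" for a b
    using fin by (intro integrable_real_indicator) auto
  have eq: "(\<integral>\<^sup>+x. ennreal (w x + c) * indicator (box a b) x \<partial>lborel)
      = (\<integral>\<^sup>+x. ennreal c * indicator (box a b) x \<partial>lborel)" for a b
  proof -
    have int_w: "integrable lborel (\<lambda>x. indicator (box a b) x * w x)"
    proof (rule Bochner_Integration.integrable_bound)
      show "integrable lborel (\<lambda>x. c * indicator (box a b) x)"
        by (intro integrable_mult_right indI)
      show "AE x in lborel. norm (indicator (box a b) x * w x) \<le> norm (c * indicator (box a b) x)"
        using wc by eventually_elim (auto simp: indicator_def)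
    qed auto
    have "(\<integral>\<^sup>+x. ennreal (w x + c) * indicator (box a b) x \<partial>lborel)
        = (\<integral>\<^sup>+x. ennreal (indicator (box a b) x * w x + c * indicator (box a b) x) \<partial>lborel)"
      by (intro nn_integral_cong) (auto simp: indicator_def)
    also have "\<dots> = ennreal (LINT x|lborel. indicator (box a b) x * w x + c * indicator (box a b) x)"
    proof (rule nn_integral_eq_integral)
      show "AE x in lborel. 0 \<le> indicator (box a b) x * w x + c * indicator (box a b) x"
        using wc by eventually_elim (auto simp: indicator_def)
    qed (use int_w indI in auto)
    also have "\<dots> = ennreal (LINT x|lborel. c * indicator (box a b) x)"
      using int_w indI zero[of a b] by (subst Bochner_Integration.integral_add) auto
    also have "\<dots> = (\<integral>\<^sup>+x. ennreal (c * indicator (box a b) x) \<partial>lborel)"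
      using c indI by (intro nn_integral_eq_integral[symmetric]) auto
    also have "\<dots> = (\<integral>\<^sup>+x. ennreal c * indicator (box a b) x \<partial>lborel)"
      by (intro nn_integral_cong) (auto simp: indicator_def)
    finally show ?thesis .
  qed
  have "density lborel (\<lambda>x. ennreal (w x + c)) = density lborel (\<lambda>x. ennreal c)"
  proof (rule measure_eqI_generator_eq)
    let ?E = "range (\<lambda>(a, b). box a b::'a set)"
    show "Int_stable ?E"
      by (auto simp: Int_stable_def box_Int_box)
    show "?E \<subseteq> Pow UNIV" "sets (density lborel (\<lambda>x. ennreal (w x + c))) = sigma_sets UNIV ?E"
      "sets (density lborel (\<lambda>x. ennreal c)) = sigma_sets UNIV ?E"
      by (simp_all add: borel_eq_box)
    let ?A = "\<lambda>n::nat. box (- (real n *\<^sub>R One)) (real n *\<^sub>R One) :: 'a set"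
    show "range ?A \<subseteq> ?E" "(\<Union>i. ?A i) = UNIV"
      unfolding UN_box_eq_UNIV by auto
    have dens: "emeasure (density lborel (\<lambda>x. ennreal (w x + c))) (box a b)
      = emeasure (density lborel (\<lambda>x. ennreal c)) (box a b)" for a b
      using eq[of a b] by (simp add: emeasure_density)
    then show "emeasure (density lborel (\<lambda>x. ennreal (w x + c))) X
      = emeasure (density lborel (\<lambda>x. ennreal c)) X" if "X \<in> ?E" for X
      using that by auto
    show "emeasure (density lborel (\<lambda>x. ennreal (w x + c))) (?A i) \<noteq> \<infinity>" for i
      unfolding dens using fin[of "- (real i *\<^sub>R One)" "real i *\<^sub>R One"]
      by (auto simp: emeasure_density nn_integral_cmult_indicator ennreal_mult_eq_top_iff)
  qed
  then have "AE x in lborel. ennreal (w x + c) = ennreal c"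
    by (intro sigma_finite_measure.density_unique[OF sigma_finite_lborel]) auto
  with wc show ?thesis
    by eventually_elim (use c in auto)
qed

text \<open>The difference quotient in direction \<open>v + w\<close> is the one in direction \<open>v\<close> plus a shift by \<open>t v\<close> of
  the one in direction \<open>w\<close>; the shift disappears in the limit after integration over a box.\<close>

lemma AE_dir_deriv_add:
  fixes u :: "'a::euclidean_space \<Rightarrow> real"
  assumes u: "C-lipschitz_on UNIV u"
  shows "AE x in lborel. dir_deriv u (v + w) x = dir_deriv u v x + dir_deriv u w x"
proof -
  have cont: "continuous_on UNIV u"
    using u by (rule lipschitz_on_continuous_on)
  note [measurable] = dir_deriv_borel[OF cont] borel_measurable_continuous_onI[OF cont]
  define t where "t = (\<lambda>n. 1 / real (Suc n))"
  have t: "t n > 0" "t n \<le> 1" for n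
    by (auto simp: t_def)
  have t0: "t \<longlonglongrightarrow> 0"
    using LIMSEQ_inverse_real_of_nat by (simp add: t_def inverse_eq_divide)
  define q where "q = (\<lambda>n v x. (u (x + t n *\<^sub>R v) - u x) / t n)"
  have q_bound: "\<bar>q n v x\<bar> \<le> C * norm v" for n v x
    unfolding q_def by (rule lipschitz_dq_bound[OF u])
  have q_lim: "AE x in lborel. (\<lambda>n. q n v x) \<longlonglongrightarrow> dir_deriv u v x" for v
    using AE_has_dir_deriv[OF u, of v]
    by eventually_elim (use has_dir_deriv_LIMSEQ in \<open>auto simp: q_def t_def\<close>)
  have [measurable]: "q n v \<in> borel_measurable borel" for n v
    unfolding q_def by measurable
  have bnd: "AE x in lborel. \<bar>dir_deriv u v x\<bar> \<le> C * norm v" for v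
    using AE_has_dir_deriv[OF u, of v] by eventually_elim (rule has_dir_deriv_bound[OF u])
  have split: "q n (v + w) x = q n v x + q n w (x + t n *\<^sub>R v)" for n x
    unfolding q_def by (simp add: scaleR_add_right add.assoc add_divide_distrib[symmetric])
  have dom: "(\<lambda>n. LINT x|lborel. indicator A x * q n v x) \<longlonglongrightarrow> (LINT x|lborel. indicator A x * dir_deriv u v x)"
    "integrable lborel (\<lambda>x. indicator A x * dir_deriv u v x)"
    "integrable lborel (\<lambda>x. indicator A x * q n v x)"
    if [measurable]: "A \<in> sets borel" and "bounded A" for A v n
  proof -
    have i: "integrable lborel (\<lambda>x. C * norm v * indicator A x)"
      using emeasure_bounded_finite[OF \<open>bounded A\<close>] that(1)
      by (intro integrable_mult_right integrable_real_indicator) auto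
    have l: "AE x in lborel. (\<lambda>n. indicator A x * q n v x) \<longlonglongrightarrow> indicator A x * dir_deriv u v x"
      using q_lim[of v] by eventually_elim (intro tendsto_intros)
    have b: "AE x in lborel. norm (indicator A x * q n v x) \<le> C * norm v * indicator A x" for n
      using q_bound[of n v] by (auto simp: indicator_def)
    show "(\<lambda>n. LINT x|lborel. indicator A x * q n v x) \<longlonglongrightarrow> (LINT x|lborel. indicator A x * dir_deriv u v x)"
      by (rule integral_dominated_convergence[OF _ _ i l b]) auto
    show "integrable lborel (\<lambda>x. indicator A x * dir_deriv u v x)"
      by (rule integrable_dominated_convergence[OF _ _ i l b]) auto
    show "integrable lborel (\<lambda>x. indicator A x * q n v x)"
      by (rule integrable_dominated_convergence2[OF _ _ i l b]) auto
  qed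
  have shifted: "(\<lambda>n. LINT x|lborel. indicator A x * q n w (x + t n *\<^sub>R v))
      \<longlonglongrightarrow> (LINT x|lborel. indicator A x * dir_deriv u w x)" if A: "A = box a b" for A a b
  proof -
    have [measurable]: "A \<in> sets borel"
      using A by auto
    \<comment> \<open>This compact set contains all translates of \<open>A\<close> by
      \<open>t n *\<^sub>R v\<close>, because \<open>t n\<close> is at most 1; its indicator serves
      for domination.\<close>
    define S where "S = {x + y |x y. x \<in> cball 0 (norm v) \<and> y \<in> closure A}"
    have "compact S"
      unfolding S_def using A by (intro compact_sums) (auto simp: compact_closure bounded_box)
    then have S[measurable]: "S \<in> sets borel" and Sb: "bounded S"
      by (auto intro: compact_imp_bounded borel_compact)
    \<comment> \<open>The substitution moves the shift from the quotient, whose limit has no known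
      continuity, to the indicator of a box, which is locally constant off a null frontier.\<close>
    have eq: "(LINT x|lborel. indicator A x * q n w (x + t n *\<^sub>R v))
        = (LINT y|lborel. indicator A (y - t n *\<^sub>R v) * q n w y)" for n
    proof -
      have "(LINT y|lborel. indicator A (y - t n *\<^sub>R v) * q n w y)
        = (LINT y|distr lborel borel ((+) (t n *\<^sub>R v)). indicator A (y - t n *\<^sub>R v) * q n w y)"
        by (simp add: lborel_distr_plus)
      also have "\<dots> = (LINT x|lborel. indicator A x * q n w (x + t n *\<^sub>R v))"
        by (subst integral_distr) (auto simp: add.commute)
      finally show ?thesis by simp
    qed
    have "(\<lambda>n. LINT y|lborel. indicator A (y - t n *\<^sub>R v) * q n w y) \<longlonglongrightarrow> (LINT y|lborel. indicator A y * dir_deriv u w y)"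
    proof (rule integral_dominated_convergence)
      show "integrable lborel (\<lambda>x. C * norm w * indicator S x)"
        using emeasure_bounded_finite[OF Sb] S
        by (intro integrable_mult_right integrable_real_indicator) auto
      have "frontier A \<in> null_sets lborel"
        using A by (auto simp: null_sets_completion_iff[symmetric] negligible_iff_null_sets[symmetric] intro!: negligible_convex_frontier)
      then have "AE y in lborel. y \<notin> frontier A"
        by (rule AE_not_in)
      with q_lim[of w] show "AE y in lborel. (\<lambda>n. indicator A (y - t n *\<^sub>R v) * q n w y) \<longlonglongrightarrow> indicator A y * dir_deriv u w y"
      proof eventually_elim
        case (elim y)
        have tend: "(\<lambda>n. y - t n *\<^sub>R v) \<longlonglongrightarrow> y"
          by (rule tendsto_eq_intros t0 refl | simp)+
        have "open A" using A by auto
        consider "y \<in> A" | "y \<in> - closure A"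
          using elim(2) \<open>open A\<close> by (auto simp: frontier_def interior_open)
        then have "\<forall>\<^sub>F n in sequentially. indicator A (y - t n *\<^sub>R v) = (indicator A y :: real)"
        proof cases
          case 1
          then show ?thesis
            using topological_tendstoD[OF tend \<open>open A\<close>] by (auto elim!: eventually_mono)
        next
          case 2
          show ?thesis
          proof -
            have "\<forall>\<^sub>F n in sequentially. y - t n *\<^sub>R v \<in> - closure A"
              using 2 by (intro topological_tendstoD[OF tend]) auto
            then show ?thesis
              using 2 closure_subset[of A] by (auto elim!: eventually_mono simp: indicator_def)
          qed
        qed
        then have "(\<lambda>n. indicator A (y - t n *\<^sub>R v) :: real) \<longlonglongrightarrow> indicator A y"
          by (rule tendsto_eventually)
        with elim(1) show ?case
          by (intro tendsto_intros)
      qed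
      show "AE y in lborel. norm (indicator A (y - t n *\<^sub>R v) * q n w y) \<le> C * norm w * indicator S y" for n
      proof (intro AE_I2)
        fix y
        have "y \<in> S" if "y - t n *\<^sub>R v \<in> A"
          unfolding S_def using that t[of n] closure_subset[of A]
          by (intro CollectI exI[of _ "t n *\<^sub>R v"] exI[of _ "y - t n *\<^sub>R v"]) (auto simp: mult_left_le_one_le)
        moreover have "0 \<le> C * norm w"
          using q_bound[of n w y] by linarith
        ultimately show "norm (indicator A (y - t n *\<^sub>R v) * q n w y) \<le> C * norm w * indicator S y"
          using q_bound[of n w y] by (auto simp: indicator_def)
      qed
    qed auto
    then show ?thesis
      by (simp add: eq)
  qed
  define d where "d = (\<lambda>x. dir_deriv u (v + w) x - (dir_deriv u v x + dir_deriv u w x))"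
  have "AE x in lborel. d x = 0"
  proof (rule AE_zero_if_box_integrals_zero)
    show "d \<in> borel_measurable borel"
      unfolding d_def by measurable
    show "AE x in lborel. \<bar>d x\<bar> \<le> C * norm (v + w) + (C * norm v + C * norm w)"
      using bnd[of "v + w"] bnd[of v] bnd[of w]
      by eventually_elim (unfold d_def, linarith)
    fix a b :: 'a
    let ?A = "box a b"
    have A: "?A \<in> sets borel" "bounded ?A" by (auto simp: bounded_box)
    have "(LINT x|lborel. indicator ?A x * q n (v + w) x)
      = (LINT x|lborel. indicator ?A x * q n v x) + (LINT x|lborel. indicator ?A x * q n w (x + t n *\<^sub>R v))" for n
    proof -
      have "indicator ?A x * q n w (x + t n *\<^sub>R v) = indicator ?A x * q n (v + w) x - indicator ?A x * q n v x" for x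
        by (simp add: split algebra_simps)
      then show ?thesis
        using dom(3)[OF A] by simp
    qed
    then have "(\<lambda>n. LINT x|lborel. indicator ?A x * q n (v + w) x) \<longlonglongrightarrow>
      (LINT x|lborel. indicator ?A x * dir_deriv u v x) + (LINT x|lborel. indicator ?A x * dir_deriv u w x)"
      using dom(1)[OF A, of v] shifted[OF refl, of a b] by (auto intro: tendsto_add)
    with dom(1)[OF A, of "v + w"] have
      "(LINT x|lborel. indicator ?A x * dir_deriv u (v + w) x)
       = (LINT x|lborel. indicator ?A x * dir_deriv u v x) + (LINT x|lborel. indicator ?A x * dir_deriv u w x)"
      using LIMSEQ_unique by blast
    moreover have "(LINT x|lborel. indicator ?A x * d x) = (LINT x|lborel. indicator ?A x * dir_deriv u (v + w) x)
       - ((LINT x|lborel. indicator ?A x * dir_deriv u v x) + (LINT x|lborel. indicator ?A x * dir_deriv u w x))"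
      using dom(2)[OF A] by (simp add: d_def right_diff_distrib distrib_left)
    ultimately show "(LINT x|lborel. indicator ?A x * d x) = 0"
      by simp
  qed
  then show ?thesis
    by eventually_elim (simp add: d_def)
qed

text \<open>The vector of partial derivatives is the candidate gradient. The exceptional null set
  still depends on \<open>v\<close>, so only countably many directions can be treated at
  once.\<close>

lemma AE_dir_deriv_linear:
  fixes u :: "'a::euclidean_space \<Rightarrow> real"
  assumes u: "C-lipschitz_on UNIV u"
  shows "AE x in lborel. has_dir_deriv u v x (v \<bullet> (\<Sum>b\<in>Basis. dir_deriv u b x *\<^sub>R b))"
proof -
  have "AE x in lborel. dir_deriv u (\<Sum>b\<in>S. (v \<bullet> b) *\<^sub>R b) x = (\<Sum>b\<in>S. (v \<bullet> b) * dir_deriv u b x)"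
    if "finite S" for S
    using that
  proof (induction S)
    case empty
    have "has_dir_deriv u 0 x 0" for x
      by (simp add: has_dir_deriv_def)
    then show ?case
      by (auto simp: has_dir_deriv_eq)
  next
    case (insert c S)
    have "AE x in lborel. dir_deriv u ((v \<bullet> c) *\<^sub>R c) x = (v \<bullet> c) * dir_deriv u c x"
      using AE_has_dir_deriv[OF u, of c]
      by eventually_elim (intro has_dir_deriv_eq has_dir_deriv_scaleR)
    with insert.IH AE_dir_deriv_add[OF u, of "(v \<bullet> c) *\<^sub>R c" "\<Sum>b\<in>S. (v \<bullet> b) *\<^sub>R b"]
    show ?case
      by eventually_elim (simp add: insert.hyps)
  qed
  from this[OF finite_Basis] AE_has_dir_deriv[OF u, of v] show ?thesis
    by eventually_elim (simp add: euclidean_representation inner_sum_right mult.commute)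
qed

text \<open>By compactness, finitely many directions from \<open>Q\<close> come within
  \<open>\<eta>\<close> of every unit vector. For these the quotients converge uniformly, and the
  Lipschitz bound carries the estimate to neighbouring directions.\<close>

lemma GDERIV_if_dense_dir_deriv:
  fixes u :: "'a::euclidean_space \<Rightarrow> real"
  assumes u: "C-lipschitz_on UNIV u"
    and Q: "\<And>U::'a set. open U \<Longrightarrow> U \<noteq> {} \<Longrightarrow> \<exists>v\<in>Q. v \<in> U"
    and G: "\<And>v. v \<in> Q \<Longrightarrow> has_dir_deriv u v x (v \<bullet> G)"
  shows "GDERIV u x :> G"
  unfolding gderiv_def has_derivative_within_alt
proof (intro conjI allI impI)
  show "bounded_linear (\<lambda>h. h \<bullet> G)"
    by (rule bounded_linear_inner_left)
  fix e :: real assume e: "0 < e"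
  have C: "0 \<le> C"
    using u by (rule lipschitz_on_nonneg)
  \<comment> \<open>Replacing a direction by a neighbour costs \<open>C * \<eta>\<close> in
    \<open>u\<close> and \<open>norm G * \<eta>\<close> in the linear term, and the quotient itself
    is off by \<open>\<eta>\<close>, all per unit length; the total is \<open>e\<close>.\<close>
  define \<eta> where "\<eta> = e / (C + 1 + norm G)"
  have pos: "0 < C + 1 + norm G"
    using C by (simp add: add_nonneg_pos add_pos_nonneg)
  have \<eta>: "0 < \<eta>"
    using e pos by (simp add: \<eta>_def)
  have "sphere (0::'a) 1 \<subseteq> (\<Union>v\<in>Q. ball v \<eta>)"
  proof
    fix w :: 'a
    obtain v where "v \<in> Q" "v \<in> ball w \<eta>"
      using Q[of "ball w \<eta>"] \<eta> by auto
    then show "w \<in> (\<Union>v\<in>Q. ball v \<eta>)"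
      by (auto simp: dist_commute)
  qed
  from compactE_image[OF compact_sphere _ this]
  obtain T where T: "T \<subseteq> Q" "finite T" "sphere (0::'a) 1 \<subseteq> (\<Union>v\<in>T. ball v \<eta>)"
    by (metis open_ball)
  have "\<forall>\<^sub>F h in at 0. \<forall>v\<in>T. dist ((u (x + h *\<^sub>R v) - u x) / h) (v \<bullet> G) < \<eta>"
    using T G \<eta> by (intro eventually_ball_finite ballI tendstoD) (auto simp: has_dir_deriv_def)
  then obtain d where d: "d > 0" "\<forall>h. h \<noteq> 0 \<and> dist h 0 < d \<longrightarrow> (\<forall>v\<in>T. dist ((u (x + h *\<^sub>R v) - u x) / h) (v \<bullet> G) < \<eta>)"
    unfolding eventually_at by blast
  show "\<exists>d>0. \<forall>y\<in>UNIV. norm (y - x) < d \<longrightarrow> norm (u y - u x - (y - x) \<bullet> G) \<le> e * norm (y - x)"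
  proof (intro exI[of _ d] conjI ballI impI d(1))
    fix y assume y: "norm (y - x) < d"
    show "norm (u y - u x - (y - x) \<bullet> G) \<le> e * norm (y - x)"
    proof (cases "y = x")
      case False
      define h where "h = norm (y - x)"
      define w where "w = (1 / h) *\<^sub>R (y - x)"
      have h: "h > 0" "y - x = h *\<^sub>R w" "norm w = 1"
        using False by (auto simp: h_def w_def)
      then have y_eq: "y = x + h *\<^sub>R w"
        by (simp add: algebra_simps)
      obtain v where v: "v \<in> T" "dist v w < \<eta>"
        using T(3) h(3) by auto
      have "\<bar>(u (x + h *\<^sub>R v) - u x) / h - v \<bullet> G\<bar> \<le> \<eta>"
        using d(2)[rule_format, of h v] h(1) y[folded h_def] v(1) by (simp add: dist_real_def)
      then have 1: "\<bar>u (x + h *\<^sub>R v) - u x - h * (v \<bullet> G)\<bar> \<le> h * \<eta>"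
        using h(1) by (simp add: abs_le_iff field_simps)
      have 0: "norm (h *\<^sub>R w - h *\<^sub>R v) \<le> h * \<eta>"
        using v h(1) by (simp add: scaleR_diff_right[symmetric] dist_norm norm_minus_commute)
      then have 2: "\<bar>u (x + h *\<^sub>R w) - u (x + h *\<^sub>R v)\<bar> \<le> C * (h * \<eta>)"
        using lipschitz_onD[OF u, of "x + h *\<^sub>R w" "x + h *\<^sub>R v"] C
          mult_left_mono[OF 0 C]
        by (simp add: dist_norm)
      have "\<bar>(v - w) \<bullet> G\<bar> \<le> \<eta> * norm G"
        using Cauchy_Schwarz_ineq2[of "v - w" G] v(2) mult_right_mono[of "norm (v - w)" \<eta> "norm G"]
        by (simp add: dist_norm)
      then have 3: "\<bar>h * (v \<bullet> G) - h * (w \<bullet> G)\<bar> \<le> h * \<eta> * norm G"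
        using h(1) by (simp add: right_diff_distrib[symmetric] inner_diff_left[symmetric] abs_mult)
      have "\<bar>u y - u x - (y - x) \<bullet> G\<bar> = \<bar>(u (x + h *\<^sub>R w) - u (x + h *\<^sub>R v)) +
          (u (x + h *\<^sub>R v) - u x - h * (v \<bullet> G)) + (h * (v \<bullet> G) - h * (w \<bullet> G))\<bar>"
        unfolding h(2) by (simp add: y_eq)
      also have "\<dots> \<le> C * (h * \<eta>) + h * \<eta> + h * \<eta> * norm G"
        using 1 2 3 by arith
      also have "\<dots> = \<eta> * (C + 1 + norm G) * h"
        by (simp add: algebra_simps)
      also have "\<dots> = e * norm (y - x)"
        using pos by (simp add: \<eta>_def h_def)
      finally show ?thesis by simp
    qed simp
  qed
qed

text \<open>The Borel field \<open>G\<close> is part of the conclusion because Fubini and the other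
  integral identities below are applied to \<open>G\<close>, which represents
  \<open>gradient u\<close> almost everywhere.\<close>

theorem rademacher:
  fixes u :: "'a::euclidean_space \<Rightarrow> real"
  assumes u: "C-lipschitz_on UNIV u"
  obtains G where "G \<in> borel_measurable borel" "AE x in lborel. GDERIV u x :> G x"
proof
  let ?G = "\<lambda>x. \<Sum>b\<in>Basis. dir_deriv u b x *\<^sub>R b"
  note [measurable] = dir_deriv_borel[OF lipschitz_on_continuous_on[OF u]]
  show "?G \<in> borel_measurable borel"
    by measurable
  obtain Q :: "'a set" where Q: "countable Q" "\<And>U. open U \<Longrightarrow> U \<noteq> {} \<Longrightarrow> \<exists>v\<in>Q. v \<in> U"
    using countable_dense_setE by blast
  have "AE x in lborel. \<forall>v\<in>Q. has_dir_deriv u v x (v \<bullet> ?G x)"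
    using Q(1) AE_dir_deriv_linear[OF u] by (simp add: AE_ball_countable)
  then show "AE x in lborel. GDERIV u x :> ?G x"
    by eventually_elim (rule GDERIV_if_dense_dir_deriv[OF u Q(2)], auto)
qed

section \<open>Capacity and the Dirichlet integral\<close>

definition test_function :: "('a::euclidean_space \<Rightarrow> real) \<Rightarrow> bool" where
  "test_function u \<longleftrightarrow> (\<exists>C. C-lipschitz_on UNIV u) \<and> compact (closure {x. u x \<noteq> 0})"

definition dirichlet :: "('a::euclidean_space \<Rightarrow> real) \<Rightarrow> ennreal" where
  "dirichlet u = (\<integral>\<^sup>+ x. ennreal ((norm (gradient u x))\<^sup>2) \<partial>lborel)"

lemma wiener_capacity_eq:
  "wiener_capacity K = Inf {dirichlet u | u. test_function u \<and> (\<forall>x\<in>K. u x = 1)}"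
  unfolding wiener_capacity_def test_function_def dirichlet_def by (simp add: conj_assoc)

lemma wiener_capacity_le:
  "test_function u \<Longrightarrow> (\<And>x. x \<in> K \<Longrightarrow> u x = 1) \<Longrightarrow> wiener_capacity K \<le> dirichlet u"
  unfolding wiener_capacity_eq by (rule Inf_lower) auto

lemma test_functionI:
  fixes u :: "'a::euclidean_space \<Rightarrow> real"
  assumes "C-lipschitz_on UNIV u" "\<And>x. u x \<noteq> 0 \<Longrightarrow> x \<in> S" "bounded S"
  shows "test_function u"
  unfolding test_function_def compact_closure
  using assms by (auto intro: bounded_subset)

lemma test_function_bounded_support:
  assumes "test_function u"
  shows "bounded {x. u x \<noteq> 0}"
  using assms by (simp add: test_function_def)

lemma test_function_bounded:
  fixes u :: "'a::euclidean_space \<Rightarrow> real"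
  assumes "test_function u"
  obtains M where "\<And>x. \<bar>u x\<bar> \<le> M"
proof -
  obtain C where "C-lipschitz_on UNIV u" and c: "compact (closure {x. u x \<noteq> 0})"
    using assms unfolding test_function_def by blast
  then have "compact (u ` closure {x. u x \<noteq> 0})"
    by (intro compact_continuous_image c) (auto intro: continuous_on_subset lipschitz_on_continuous_on)
  then obtain M where M: "\<forall>x\<in>closure {x. u x \<noteq> 0}. \<bar>u x\<bar> \<le> M"
    by (auto dest!: compact_imp_bounded simp: bounded_iff)
  have "\<bar>u x\<bar> \<le> max M 0" for x
  proof (cases "u x = 0")
    case False
    then have "x \<in> closure {x. u x \<noteq> 0}"
      using closure_subset[of "{x. u x \<noteq> 0}"] by blast
    then show ?thesis
      using M by fastforce
  qed simp
  then show ?thesis by (rule that)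
qed

lemma lipschitz_on_mult_bounded:
  fixes f g :: "'a::metric_space \<Rightarrow> real"
  assumes f: "C-lipschitz_on U f" "\<And>x. x \<in> U \<Longrightarrow> \<bar>f x\<bar> \<le> A"
    and g: "D-lipschitz_on U g" "\<And>x. x \<in> U \<Longrightarrow> \<bar>g x\<bar> \<le> B" and AB: "0 \<le> A" "0 \<le> B"
  shows "(A * D + B * C)-lipschitz_on U (\<lambda>x. f x * g x)"
proof (rule lipschitz_onI)
  fix x y assume xy: "x \<in> U" "y \<in> U"
  have "\<bar>f x * g x - f y * g y\<bar> = \<bar>f x * (g x - g y) + g y * (f x - f y)\<bar>"
    by (simp add: algebra_simps)
  also have "\<dots> \<le> \<bar>f x\<bar> * \<bar>g x - g y\<bar> + \<bar>g y\<bar> * \<bar>f x - f y\<bar>"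
    by (metis abs_mult abs_triangle_ineq)
  also have "\<dots> \<le> A * (D * dist x y) + B * (C * dist x y)"
    using lipschitz_onD[OF f(1) xy] lipschitz_onD[OF g(1) xy] f(2)[OF xy(1)] g(2)[OF xy(2)] AB
    by (intro add_mono mult_mono) (auto simp: dist_real_def)
  finally show "dist (f x * g x) (f y * g y) \<le> (A * D + B * C) * dist x y"
    by (simp add: dist_real_def algebra_simps)
qed (use AB lipschitz_on_nonneg[OF f(1)] lipschitz_on_nonneg[OF g(1)] in auto)

lemma norm_gradient_le:
  fixes u :: "'a::euclidean_space \<Rightarrow> real"
  assumes "C-lipschitz_on UNIV u"
  shows "norm (gradient u x) \<le> C"
proof (cases "\<exists>D. GDERIV u x :> D")
  case True
  then obtain D where "GDERIV u x :> D" by blast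
  then show ?thesis
    using GDERIV_lipschitz_bound[OF assms] GDERIV_imp_gradient by metis
next
  case False
  then show ?thesis
    using lipschitz_on_nonneg[OF assms] by (simp add: gradient_def)
qed

lemma gradient_eq_0_if_locally_0:
  assumes "open S" "x \<in> S" "\<And>y. y \<in> S \<Longrightarrow> u y = 0"
  shows "gradient u x = 0"
proof (rule GDERIV_imp_gradient)
  have "(u has_derivative (\<lambda>h. 0)) (at x)"
    by (rule has_derivative_transform_within_open[OF has_derivative_const[of 0] assms(1,2)])
      (use assms(3) in auto)
  then show "GDERIV u x :> 0"
    by (simp add: gderiv_def)
qed

lemma dirichlet_eq:
  assumes "AE x in lborel. GDERIV u x :> G x"
  shows "dirichlet u = (\<integral>\<^sup>+ x. ennreal ((norm (G x))\<^sup>2) \<partial>lborel)"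
  unfolding dirichlet_def
  by (rule nn_integral_cong_AE) (use assms in \<open>auto elim!: eventually_mono simp: GDERIV_imp_gradient\<close>)

section \<open>Radial cutoffs with a linear layer of width \<open>s\<close>\<close>

definition cutoff :: "'a::euclidean_space \<Rightarrow> real \<Rightarrow> real \<Rightarrow> 'a \<Rightarrow> real" where
  "cutoff z \<rho> s x = max 0 (min 1 ((\<rho> + s - dist x z) / s))"

lemma cutoff_01: "0 \<le> cutoff z \<rho> s x" "cutoff z \<rho> s x \<le> 1" "\<bar>cutoff z \<rho> s x\<bar> \<le> 1"
  by (auto simp: cutoff_def)

lemma cutoff_eq_1: "0 < s \<Longrightarrow> x \<in> cball z \<rho> \<Longrightarrow> cutoff z \<rho> s x = 1"
  by (simp add: cutoff_def dist_commute)

lemma cutoff_eq_0: "0 < s \<Longrightarrow> x \<notin> cball z (\<rho> + s) \<Longrightarrow> cutoff z \<rho> s x = 0"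
  by (auto simp: cutoff_def dist_commute zero_le_divide_iff max_def min_def)

lemma cutoff_lipschitz:
  fixes z :: "'a::euclidean_space"
  assumes s: "0 < s"
  shows "(1 / s)-lipschitz_on UNIV (cutoff z \<rho> s)"
proof (rule lipschitz_onI)
  fix x y :: 'a
  have "\<bar>cutoff z \<rho> s x - cutoff z \<rho> s y\<bar> \<le> \<bar>(\<rho> + s - dist x z) / s - (\<rho> + s - dist y z) / s\<bar>"
    unfolding cutoff_def by linarith
  also have "\<dots> = \<bar>dist y z - dist x z\<bar> / s"
    using s by (simp add: diff_divide_distrib[symmetric] abs_divide)
  also have "\<dots> \<le> dist x y / s"
    using s abs_dist_diff_le[of y z x] by (intro divide_right_mono) (auto simp: dist_commute)
  finally show "dist (cutoff z \<rho> s x) (cutoff z \<rho> s y) \<le> 1 / s * dist x y"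
    by (simp add: dist_real_def)
qed (use s in auto)

lemma norm_gradient_cutoff:
  fixes z :: "'a::euclidean_space"
  assumes s: "0 < s"
  shows "norm (gradient (cutoff z \<rho> s) x) \<le> 1 / s"
    and "x \<notin> cball z (\<rho> + s) \<Longrightarrow> gradient (cutoff z \<rho> s) x = 0"
proof -
  show "norm (gradient (cutoff z \<rho> s) x) \<le> 1 / s"
    by (intro norm_gradient_le cutoff_lipschitz s)
  show "gradient (cutoff z \<rho> s) x = 0" if "x \<notin> cball z (\<rho> + s)"
    by (rule gradient_eq_0_if_locally_0[of "- cball z (\<rho> + s)"]) (use that cutoff_eq_0[OF s] in auto)
qed

lemma AE_GDERIV_gradient:
  fixes u :: "'a::euclidean_space \<Rightarrow> real"
  assumes "C-lipschitz_on UNIV u"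
  shows "AE x in lborel. GDERIV u x :> gradient u x"
proof -
  obtain G where "AE x in lborel. GDERIV u x :> G x"
    using rademacher[OF assms] by blast
  then show ?thesis
    by eventually_elim (simp add: GDERIV_imp_gradient)
qed

text \<open>The increment over \<open>h\<close> is split into \<open>N\<close> increments over \<open>h / N\<close>. Translation invariance
  makes their \<open>L\<^sup>2\<close> norms equal, so only the limit of difference quotients is needed,
  and no integration along lines.\<close>

lemma L2_increment_le_dirichlet:
  fixes u :: "'a::euclidean_space \<Rightarrow> real"
  assumes u: "test_function u"
  shows "(\<integral>\<^sup>+ y. ennreal ((u (y + h) - u y)\<^sup>2) \<partial>lborel) \<le> ennreal ((norm h)\<^sup>2) * dirichlet u"
proof -
  obtain C where C: "C-lipschitz_on UNIV u"
    using u unfolding test_function_def by blast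
  note [measurable] = borel_measurable_continuous_onI[OF lipschitz_on_continuous_on[OF C]]
  obtain G where G[measurable]: "G \<in> borel_measurable borel" "AE x in lborel. GDERIV u x :> G x"
    using rademacher[OF C] by blast
  define q where "q = (\<lambda>n y. (u (y + (1 / real (Suc n)) *\<^sub>R h) - u y) / (1 / real (Suc n)))"
  have [measurable]: "q n \<in> borel_measurable borel" for n
    unfolding q_def by measurable
  have le: "(\<integral>\<^sup>+ y. ennreal ((u (y + h) - u y)\<^sup>2) \<partial>lborel) \<le> (\<integral>\<^sup>+ y. ennreal ((q n y)\<^sup>2) \<partial>lborel)" for n
  proof -
    define N where "N = Suc n"
    define k where "k = (1 / real N) *\<^sub>R h"
    define f where "f = (\<lambda>y. u (y + k) - u y)"
    have [measurable]: "f \<in> borel_measurable borel"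
      unfolding f_def by measurable
    have tele: "u (y + h) - u y = (\<Sum>i<N. f (y + real i *\<^sub>R k))" for y
    proof -
      have "(\<Sum>i<N. f (y + real i *\<^sub>R k)) = (\<Sum>i<N. u (y + real (Suc i) *\<^sub>R k) - u (y + real i *\<^sub>R k))"
        unfolding f_def by (intro sum.cong) (auto simp: scaleR_add_left add_ac)
      also have "\<dots> = u (y + real N *\<^sub>R k) - u (y + real 0 *\<^sub>R k)"
        by (rule sum_lessThan_telescope)
      finally show ?thesis
        by (simp add: k_def N_def)
    qed
    have "(\<integral>\<^sup>+ y. ennreal ((u (y + h) - u y)\<^sup>2) \<partial>lborel)
      \<le> (\<integral>\<^sup>+ y. (\<Sum>i<N. ennreal (real N * (f (y + real i *\<^sub>R k))\<^sup>2)) \<partial>lborel)"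
    proof (rule nn_integral_mono)
      fix y
      \<comment> \<open>Cauchy-Schwarz costs one factor \<open>N\<close>. After translation the
        \<open>N\<close> summands have equal integrals, which gives a second one, and
        \<open>N * N * (f y)\<^sup>2\<close> is exactly the squared difference quotient.\<close>
      have "(u (y + h) - u y)\<^sup>2 \<le> (\<Sum>i<N. real N * (f (y + real i *\<^sub>R k))\<^sup>2)"
        unfolding tele using sum_squared_le_sum_of_squares[of "\<lambda>i. f (y + real i *\<^sub>R k)" "{..<N}"]
        by (simp add: sum_distrib_left mult.commute)
      then show "ennreal ((u (y + h) - u y)\<^sup>2) \<le> (\<Sum>i<N. ennreal (real N * (f (y + real i *\<^sub>R k))\<^sup>2))"
        by (simp add: sum_ennreal ennreal_leI)
    qed
    also have "\<dots> = (\<Sum>i<N. \<integral>\<^sup>+ y. ennreal (real N * (f (y + real i *\<^sub>R k))\<^sup>2) \<partial>lborel)"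
      by (rule nn_integral_sum) measurable
    also have "\<dots> = (\<Sum>i<N. \<integral>\<^sup>+ y. ennreal (real N * (f y)\<^sup>2) \<partial>lborel)"
      by (intro sum.cong refl nn_integral_lborel_translate[of "\<lambda>y. ennreal (real N * (f y)\<^sup>2)"]) measurable
    also have "\<dots> = (\<integral>\<^sup>+ y. ennreal (real N) * ennreal (real N * (f y)\<^sup>2) \<partial>lborel)"
      by (subst nn_integral_cmult) (auto simp: ennreal_of_nat_eq_real_of_nat)
    also have "\<dots> = (\<integral>\<^sup>+ y. ennreal ((q n y)\<^sup>2) \<partial>lborel)"
    proof (intro nn_integral_cong)
      fix y
      have "q n y = real N * f y"
        by (simp add: q_def f_def k_def N_def)
      then show "ennreal (real N) * ennreal (real N * (f y)\<^sup>2) = ennreal ((q n y)\<^sup>2)"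
        by (simp add: ennreal_mult[symmetric] power2_eq_square algebra_simps)
    qed
    finally show ?thesis .
  qed
  obtain B where B: "\<And>x. u x \<noteq> 0 \<Longrightarrow> norm x \<le> B"
    using test_function_bounded_support[OF u] unfolding bounded_iff by auto
  \<comment> \<open>All quotients \<open>q n\<close> vanish outside this ball, since their shifts
    are no longer than \<open>h\<close>.\<close>
  let ?S = "cball (0::'a) (B + norm h)"
  have [measurable]: "?S \<in> sets borel" by simp
  have "(\<lambda>n. \<integral>\<^sup>+ y. ennreal ((q n y)\<^sup>2) \<partial>lborel) \<longlonglongrightarrow> (\<integral>\<^sup>+ y. ennreal ((h \<bullet> G y)\<^sup>2) \<partial>lborel)"
  proof (rule nn_integral_dominated_convergence)
    show "AE y in lborel. ennreal ((q n y)\<^sup>2) \<le> ennreal ((C * norm h)\<^sup>2) * indicator ?S y" for n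
    proof (intro AE_I2)
      fix y
      show "ennreal ((q n y)\<^sup>2) \<le> ennreal ((C * norm h)\<^sup>2) * indicator ?S y"
      proof (cases "y \<in> ?S")
        case True
        have "\<bar>q n y\<bar> \<le> \<bar>C * norm h\<bar>"
          unfolding q_def using lipschitz_dq_bound[OF C, of y "1 / real (Suc n)" h] by linarith
        then show ?thesis
          using True by (simp add: ennreal_leI abs_le_square_iff)
      next
        case False
        have n: "norm ((1 / real (Suc n)) *\<^sub>R h) \<le> norm h"
          by (simp add: divide_le_eq mult_le_cancel_left1)
        have "u y = 0"
          using B[of y] norm_ge_zero[of h] False unfolding mem_cball dist_0_norm by linarith
        moreover have "u (y + (1 / real (Suc n)) *\<^sub>R h) = 0"
          using B[of "y + (1 / real (Suc n)) *\<^sub>R h"] False n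
            norm_diff_ineq[of y "(1 / real (Suc n)) *\<^sub>R h"]
          unfolding mem_cball dist_0_norm by linarith
        ultimately show ?thesis
          by (simp add: q_def)
      qed
    qed
    show "(\<integral>\<^sup>+ y. ennreal ((C * norm h)\<^sup>2) * indicator ?S y \<partial>lborel) < \<infinity>"
      using emeasure_bounded_finite[OF bounded_cball, of "0::'a" "B + norm h"]
      by (subst nn_integral_cmult_indicator) (auto simp: ennreal_mult_less_top)
    show "AE y in lborel. (\<lambda>n. ennreal ((q n y)\<^sup>2)) \<longlonglongrightarrow> ennreal ((h \<bullet> G y)\<^sup>2)"
      using G(2)
    proof eventually_elim
      case (elim y)
      have "(\<lambda>n. q n y) \<longlonglongrightarrow> h \<bullet> G y"
        unfolding q_def by (intro has_dir_deriv_LIMSEQ has_dir_deriv_GDERIV elim)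
      then show ?case
        by (intro tendsto_intros)
    qed
  qed measurable
  then have "(\<integral>\<^sup>+ y. ennreal ((u (y + h) - u y)\<^sup>2) \<partial>lborel) \<le> (\<integral>\<^sup>+ y. ennreal ((h \<bullet> G y)\<^sup>2) \<partial>lborel)"
    by (rule LIMSEQ_le_const) (use le in blast)
  also have "\<dots> \<le> (\<integral>\<^sup>+ y. ennreal ((norm h)\<^sup>2) * ennreal ((norm (G y))\<^sup>2) \<partial>lborel)"
  proof (intro nn_integral_mono)
    fix y
    have "(h \<bullet> G y)\<^sup>2 \<le> (norm h)\<^sup>2 * (norm (G y))\<^sup>2"
      using Cauchy_Schwarz_ineq[of h "G y"] by (simp add: power2_norm_eq_inner)
    then show "ennreal ((h \<bullet> G y)\<^sup>2) \<le> ennreal ((norm h)\<^sup>2) * ennreal ((norm (G y))\<^sup>2)"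
      by (simp add: ennreal_mult[symmetric] ennreal_leI)
  qed
  also have "\<dots> = ennreal ((norm h)\<^sup>2) * dirichlet u"
    unfolding dirichlet_eq[OF G(2)] by (rule nn_integral_cmult) measurable
  finally show ?thesis .
qed

section \<open>Energy estimates for functions modified by cutoffs\<close>

lemma power2_norm_add_le:
  fixes a b :: "'a::real_inner"
  assumes d: "0 < d"
  shows "(norm (a + b))\<^sup>2 \<le> (1 + d) * (norm a)\<^sup>2 + (1 + 1 / d) * (norm b)\<^sup>2"
proof -
  \<comment> \<open>Young's inequality with a parameter: a small \<open>d\<close> keeps the
    coefficient of the first term close to 1, as needed for the large ball, whereas
    \<open>d = 1\<close> is enough for the local estimate.\<close>
  have "0 \<le> (norm (d *\<^sub>R a - b))\<^sup>2 / d"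
    using d by simp
  also have "(norm (d *\<^sub>R a - b))\<^sup>2 / d = d * (norm a)\<^sup>2 - 2 * (a \<bullet> b) + (norm b)\<^sup>2 / d"
    unfolding power2_norm_eq_inner using d
    by (simp add: inner_diff_left inner_diff_right inner_commute field_simps)
  finally have "2 * (a \<bullet> b) \<le> d * (norm a)\<^sup>2 + (norm b)\<^sup>2 / d"
    by simp
  moreover have "(norm (a + b))\<^sup>2 = (norm a)\<^sup>2 + (norm b)\<^sup>2 + 2 * (a \<bullet> b)"
    unfolding power2_norm_eq_inner by (simp add: inner_add_left inner_add_right inner_commute)
  ultimately show ?thesis
    by (simp add: algebra_simps)
qed

text \<open>Normalising by the value \<open>u y\<close> at the centre, rather than by a mean value, makes a
  Poincare inequality unnecessary.\<close>

lemma capacity_times_square_le: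
  fixes u :: "'a::euclidean_space \<Rightarrow> real"
  assumes u: "test_function u" and G[measurable]: "G \<in> borel_measurable borel"
    and GD: "AE x in lborel. GDERIV u x :> G x"
    and r: "0 < r" and K: "K \<subseteq> cball y r" "\<And>x. x \<in> K \<Longrightarrow> u x = 1"
  shows "wiener_capacity K * ennreal ((1 - u y)\<^sup>2) \<le>
    (\<integral>\<^sup>+ h. indicator (cball 0 (2 * r)) h *
      ennreal (2 / r\<^sup>2 * (u (y + h) - u y)\<^sup>2 + 2 * (norm (G (y + h)))\<^sup>2) \<partial>lborel)"
proof (cases "u y = 1")
  case False
  define m where "m = 1 - u y"
  have m: "m \<noteq> 0" using False by (simp add: m_def)
  obtain C where C: "C-lipschitz_on UNIV u"
    using u unfolding test_function_def by blast
  obtain M where M: "\<And>x. \<bar>u x\<bar> \<le> M"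
    using test_function_bounded[OF u] by blast
  note [measurable] = borel_measurable_continuous_onI[OF lipschitz_on_continuous_on[OF C]]
  let ?c = "cutoff y r r" and ?B = "cball y (2 * r)"
  have [measurable]: "?B \<in> sets borel" by simp
  have rr: "r + r = 2 * r" by simp
  \<comment> \<open>On \<open>K\<close> the quotient is 1 because \<open>u\<close> is, and the
    cutoff is 1 because \<open>K\<close> lies in \<open>cball y r\<close>.\<close>
  define \<psi> where "\<psi> = (\<lambda>x. ?c x * (1 / m * (u x - u y)))"
  let ?R = "\<lambda>x. 2 / r\<^sup>2 * (u x - u y)\<^sup>2 + 2 * (norm (G x))\<^sup>2"
  have "\<exists>D. D-lipschitz_on UNIV \<psi>"
  proof -
    have 1: "(\<bar>1 / m\<bar> * (C + 0))-lipschitz_on UNIV (\<lambda>x. 1 / m * (u x - u y))"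
      by (intro lipschitz_on_cmult_real lipschitz_on_diff C lipschitz_on_constant)
    have 2: "\<bar>1 / m * (u x - u y)\<bar> \<le> \<bar>1 / m\<bar> * (2 * M)" for x
      unfolding abs_mult using M[of x] M[of y] by (intro mult_left_mono) linarith+
    have "0 \<le> M"
      using M[of y] by linarith
    then show ?thesis
      unfolding \<psi>_def
      using lipschitz_on_mult_bounded[OF cutoff_lipschitz[OF r, of y r] cutoff_01(3) 1 2] by auto
  qed
  moreover have "x \<in> ?B" if "\<psi> x \<noteq> 0" for x
    using that cutoff_eq_0[OF r, of x y r] unfolding \<psi>_def rr by auto
  ultimately have "test_function \<psi>"
    using test_functionI bounded_cball by metis
  moreover have "\<psi> x = 1" if "x \<in> K" for x
    using that K cutoff_eq_1[OF r, of x y r] m by (auto simp: \<psi>_def m_def)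
  ultimately have "wiener_capacity K \<le> dirichlet \<psi>"
    by (rule wiener_capacity_le)
  also have "\<dots> \<le> (\<integral>\<^sup>+ x. ennreal (1 / m\<^sup>2) * (indicator ?B x * ennreal (?R x)) \<partial>lborel)"
    unfolding dirichlet_def
  proof (rule nn_integral_mono_AE)
    show "AE x in lborel. ennreal ((norm (gradient \<psi> x))\<^sup>2) \<le> ennreal (1 / m\<^sup>2) * (indicator ?B x * ennreal (?R x))"
      using GD AE_GDERIV_gradient[OF cutoff_lipschitz[OF r, of y r]]
    proof eventually_elim
      case (elim x)
      let ?a = "gradient ?c x"
      have "GDERIV (\<lambda>x. 1 / m * (u x - u y)) x :> (1 / m) *\<^sub>R (G x - 0) + (u x - u y) *\<^sub>R 0"
        by (intro GDERIV_mult GDERIV_diff GDERIV_const elim)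
      from GDERIV_mult[OF elim(2) this] have "GDERIV \<psi> x :> ?c x *\<^sub>R ((1 / m) *\<^sub>R (G x - 0) + (u x - u y) *\<^sub>R 0) + (1 / m * (u x - u y)) *\<^sub>R ?a"
        unfolding \<psi>_def .
      then have grad: "gradient \<psi> x = (1 / m) *\<^sub>R (?c x *\<^sub>R G x + (u x - u y) *\<^sub>R ?a)"
        by (simp add: GDERIV_imp_gradient scaleR_add_right)
      show ?case
      proof (cases "x \<in> ?B")
        case True
        have "(norm (?c x *\<^sub>R G x + (u x - u y) *\<^sub>R ?a))\<^sup>2
          \<le> 2 * (norm (?c x *\<^sub>R G x))\<^sup>2 + 2 * (norm ((u x - u y) *\<^sub>R ?a))\<^sup>2"
          using power2_norm_add_le[of 1 "?c x *\<^sub>R G x" "(u x - u y) *\<^sub>R ?a"] by (simp del: norm_scaleR)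
        also have "\<dots> \<le> 2 * (norm (G x))\<^sup>2 + 2 * ((u x - u y)\<^sup>2 * (1 / r)\<^sup>2)"
        proof (intro add_mono mult_left_mono)
          show "(norm (?c x *\<^sub>R G x))\<^sup>2 \<le> (norm (G x))\<^sup>2"
            using cutoff_01(3)[of y r r x] by (intro power_mono) (auto simp: mult_left_le_one_le)
          have "(norm ?a)\<^sup>2 \<le> (1 / r)\<^sup>2"
            using norm_gradient_cutoff(1)[OF r, of y r x] by (intro power_mono) auto
          then show "(norm ((u x - u y) *\<^sub>R ?a))\<^sup>2 \<le> (u x - u y)\<^sup>2 * (1 / r)\<^sup>2"
            by (simp add: power_mult_distrib mult_left_mono)
        qed auto
        also have "\<dots> = ?R x"
          by (simp add: power_divide)
        finally have "(norm (?c x *\<^sub>R G x + (u x - u y) *\<^sub>R ?a))\<^sup>2 \<le> ?R x" .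
        then have "(norm (gradient \<psi> x))\<^sup>2 \<le> 1 / m\<^sup>2 * ?R x"
          unfolding grad norm_scaleR power_mult_distrib
          by (simp add: power_divide divide_right_mono)
        then show ?thesis
          using True by (simp add: ennreal_mult'[symmetric] ennreal_leI del: ennreal_plus)
      next
        case False
        then show ?thesis
          using cutoff_eq_0[OF r, of x y r] norm_gradient_cutoff(2)[OF r, of x y r]
          unfolding grad rr by simp
      qed
    qed
  qed
  also have "\<dots> = ennreal (1 / m\<^sup>2) * (\<integral>\<^sup>+ x. indicator ?B x * ennreal (?R x) \<partial>lborel)"
    by (rule nn_integral_cmult) measurable
  finally have "wiener_capacity K * ennreal (m\<^sup>2) \<le> ennreal (1 / m\<^sup>2) * (\<integral>\<^sup>+ x. indicator ?B x * ennreal (?R x) \<partial>lborel) * ennreal (m\<^sup>2)"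
    by (rule mult_right_mono) simp
  also have "\<dots> = ennreal (1 / m\<^sup>2 * m\<^sup>2) * (\<integral>\<^sup>+ x. indicator ?B x * ennreal (?R x) \<partial>lborel)"
    by (subst ennreal_mult) (auto simp: mult_ac)
  also have "\<dots> = (\<integral>\<^sup>+ x. indicator ?B x * ennreal (?R x) \<partial>lborel)"
    using m by simp
  \<comment> \<open>With the displacement \<open>h\<close> as variable the domain no longer depends
    on \<open>y\<close>, ready for an exchange of integrals.\<close>
  also have "\<dots> = (\<integral>\<^sup>+ h. indicator ?B (h + y) * ennreal (?R (h + y)) \<partial>lborel)"
    by (rule nn_integral_lborel_translate[symmetric]) measurable
  also have "\<dots> = (\<integral>\<^sup>+ h. indicator (cball 0 (2 * r)) h * ennreal (?R (y + h)) \<partial>lborel)"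
    by (intro nn_integral_cong arg_cong2[where f="(*)"]) (auto simp: indicator_def dist_norm add.commute)
  finally show ?thesis
    by (simp add: m_def)
qed simp

text \<open>The local bound is integrated over \<open>y\<close> and the integrals exchanged. For
  each \<open>h\<close> of length at most \<open>2 * r\<close>, the increments contribute
  \<open>2 / r\<^sup>2 * (2 * r)\<^sup>2 = 8\<close> and the gradient 2 Dirichlet integrals, which
  explains the 10; integrating over \<open>h\<close> gives the volume.\<close>

lemma L2_le_dirichlet:
  fixes u :: "'a::euclidean_space \<Rightarrow> real"
  assumes u: "test_function u" and r: "0 < r" and A[measurable]: "A \<in> sets borel"
    and F: "\<And>x y. y \<in> A \<Longrightarrow> x \<in> F \<inter> cball y r \<Longrightarrow> u x = 1"
    and c: "\<And>y. c \<le> wiener_capacity (F \<inter> cball y r)"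
  shows "c * (\<integral>\<^sup>+ y. indicator A y * ennreal ((1 - u y)\<^sup>2) \<partial>lborel)
    \<le> 10 * emeasure lborel (cball (0::'a) (2 * r)) * dirichlet u"
proof -
  obtain C where C: "C-lipschitz_on UNIV u"
    using u unfolding test_function_def by blast
  note [measurable] = borel_measurable_continuous_onI[OF lipschitz_on_continuous_on[OF C]]
  obtain G where G[measurable]: "G \<in> borel_measurable borel" "AE x in lborel. GDERIV u x :> G x"
    using rademacher[OF C] by blast
  let ?B = "cball (0::'a) (2 * r)"
  have [measurable]: "?B \<in> sets borel" by simp
  let ?R = "\<lambda>y h. ennreal (2 / r\<^sup>2 * (u (y + h) - u y)\<^sup>2 + 2 * (norm (G (y + h)))\<^sup>2)"
  have "c * (\<integral>\<^sup>+ y. indicator A y * ennreal ((1 - u y)\<^sup>2) \<partial>lborel)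
    = (\<integral>\<^sup>+ y. c * (indicator A y * ennreal ((1 - u y)\<^sup>2)) \<partial>lborel)"
    by (rule nn_integral_cmult[symmetric]) measurable
  also have "\<dots> \<le> (\<integral>\<^sup>+ y. (\<integral>\<^sup>+ h. indicator ?B h * ?R y h \<partial>lborel) \<partial>lborel)"
  proof (rule nn_integral_mono)
    fix y
    show "c * (indicator A y * ennreal ((1 - u y)\<^sup>2)) \<le> (\<integral>\<^sup>+ h. indicator ?B h * ?R y h \<partial>lborel)"
    proof (cases "y \<in> A")
      case True
      have "c * ennreal ((1 - u y)\<^sup>2) \<le> wiener_capacity (F \<inter> cball y r) * ennreal ((1 - u y)\<^sup>2)"
        using c by (rule mult_right_mono) simp
      also have "\<dots> \<le> (\<integral>\<^sup>+ h. indicator ?B h * ?R y h \<partial>lborel)"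
        by (rule capacity_times_square_le[OF u G r]) (use F[OF True] in auto)
      finally show ?thesis
        using True by simp
    qed simp
  qed
  also have "\<dots> = (\<integral>\<^sup>+ h. (\<integral>\<^sup>+ y. indicator ?B h * ?R y h \<partial>lborel) \<partial>lborel)"
    by (rule lborel_pair.Fubini') measurable
  also have "\<dots> \<le> (\<integral>\<^sup>+ h. (10 * dirichlet u) * indicator ?B h \<partial>lborel)"
  proof (rule nn_integral_mono)
    fix h
    show "(\<integral>\<^sup>+ y. indicator ?B h * ?R y h \<partial>lborel) \<le> 10 * dirichlet u * indicator ?B h"
    proof (cases "h \<in> ?B")
      case True
      have "(\<integral>\<^sup>+ y. ?R y h \<partial>lborel) = (\<integral>\<^sup>+ y. ennreal (2 / r\<^sup>2) * ennreal ((u (y + h) - u y)\<^sup>2) + 2 * ennreal ((norm (G (y + h)))\<^sup>2) \<partial>lborel)"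
        by (intro nn_integral_cong) (simp add: ennreal_mult[symmetric] flip: ennreal_plus ennreal_numeral)
      also have "\<dots> = ennreal (2 / r\<^sup>2) * (\<integral>\<^sup>+ y. ennreal ((u (y + h) - u y)\<^sup>2) \<partial>lborel)
          + 2 * (\<integral>\<^sup>+ y. ennreal ((norm (G (y + h)))\<^sup>2) \<partial>lborel)"
        by (subst nn_integral_add) (auto simp: nn_integral_cmult)
      also have "(\<integral>\<^sup>+ y. ennreal ((norm (G (y + h)))\<^sup>2) \<partial>lborel) = dirichlet u"
        unfolding dirichlet_eq[OF G(2)]
        by (rule nn_integral_lborel_translate[of "\<lambda>y. ennreal ((norm (G y))\<^sup>2)"]) measurable
      also have "ennreal (2 / r\<^sup>2) * (\<integral>\<^sup>+ y. ennreal ((u (y + h) - u y)\<^sup>2) \<partial>lborel)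
          \<le> ennreal (2 / r\<^sup>2) * (ennreal ((norm h)\<^sup>2) * dirichlet u)"
        by (intro mult_left_mono L2_increment_le_dirichlet u) auto
      also have "\<dots> = ennreal (2 / r\<^sup>2 * (norm h)\<^sup>2) * dirichlet u"
        by (subst ennreal_mult) (auto simp: mult.assoc)
      also have "\<dots> \<le> 8 * dirichlet u"
      proof (rule mult_right_mono)
        have "(norm h)\<^sup>2 \<le> (2 * r)\<^sup>2"
          using True by (intro power_mono) auto
        then have "2 / r\<^sup>2 * (norm h)\<^sup>2 \<le> 8"
          using r by (simp add: field_simps power_mult_distrib)
        then show "ennreal (2 / r\<^sup>2 * (norm h)\<^sup>2) \<le> 8"
          using ennreal_leI by fastforce
      qed simp
      also have "8 * dirichlet u + 2 * dirichlet u = 10 * dirichlet u"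
        by (simp add: distrib_right[symmetric])
      finally show ?thesis
        using True by (simp add: add_right_mono)
    qed simp
  qed
  also have "\<dots> = 10 * dirichlet u * emeasure lborel ?B"
    by (rule nn_integral_cmult_indicator) simp
  finally show ?thesis
    by (simp add: mult_ac)
qed

text \<open>The competitor \<open>w\<close> satisfies \<open>1 - w = (1 - ?c) * (1 - u)\<close>. Its
  gradient is a contraction of that of \<open>u\<close> plus \<open>(1 - u)\<close> times the cutoff
  gradient, which is at most \<open>1 / s\<close> and vanishes outside the larger ball.\<close>

lemma wiener_capacity_cball_le:
  fixes u :: "'a::euclidean_space \<Rightarrow> real"
  assumes u: "test_function u" and s: "0 < s" and d: "0 < d"
  shows "wiener_capacity (cball z \<rho>) \<le> ennreal (1 + d) * dirichlet u
    + ennreal ((1 + 1 / d) / s\<^sup>2) * (\<integral>\<^sup>+ x. indicator (cball z (\<rho> + s)) x * ennreal ((1 - u x)\<^sup>2) \<partial>lborel)"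
proof -
  obtain C where C: "C-lipschitz_on UNIV u"
    using u unfolding test_function_def by blast
  note [measurable] = borel_measurable_continuous_onI[OF lipschitz_on_continuous_on[OF C]]
  obtain G where G[measurable]: "G \<in> borel_measurable borel" "AE x in lborel. GDERIV u x :> G x"
    using rademacher[OF C] by blast
  obtain M where M: "\<And>x. \<bar>u x\<bar> \<le> M"
    using test_function_bounded[OF u] by blast
  let ?c = "cutoff z \<rho> s" and ?B = "cball z (\<rho> + s)"
  have [measurable]: "?B \<in> sets borel" by simp
  define w where "w = (\<lambda>x. u x + ?c x * (1 - u x))"
  have "\<exists>D. D-lipschitz_on UNIV w"
  proof -
    have 1: "(0 + C)-lipschitz_on UNIV (\<lambda>x. 1 - u x)"
      by (intro lipschitz_on_diff C lipschitz_on_constant)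
    have 2: "\<bar>1 - u x\<bar> \<le> 1 + M" for x
      using M[of x] by linarith
    have "0 \<le> 1 + M"
      using M[of z] by linarith
    then show ?thesis
      unfolding w_def
      using lipschitz_on_add[OF C lipschitz_on_mult_bounded[OF cutoff_lipschitz[OF s, of z \<rho>] cutoff_01(3) 1 2]] by auto
  qed
  moreover have "x \<in> {x. u x \<noteq> 0} \<union> ?B" if "w x \<noteq> 0" for x
    using that cutoff_eq_0[OF s, of x z \<rho>] unfolding w_def by (cases "x \<in> ?B") auto
  moreover have "bounded ({x. u x \<noteq> 0} \<union> ?B)"
    using test_function_bounded_support[OF u] by simp
  ultimately have "test_function w"
    using test_functionI by metis
  moreover have "w x = 1" if "x \<in> cball z \<rho>" for x
    using that cutoff_eq_1[OF s, of x z \<rho>] by (auto simp: w_def)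
  ultimately have "wiener_capacity (cball z \<rho>) \<le> dirichlet w"
    by (rule wiener_capacity_le)
  also have "\<dots> \<le> (\<integral>\<^sup>+ x. ennreal (1 + d) * ennreal ((norm (G x))\<^sup>2)
      + ennreal ((1 + 1 / d) / s\<^sup>2) * (indicator ?B x * ennreal ((1 - u x)\<^sup>2)) \<partial>lborel)"
    unfolding dirichlet_def
  proof (rule nn_integral_mono_AE)
    show "AE x in lborel. ennreal ((norm (gradient w x))\<^sup>2) \<le> ennreal (1 + d) * ennreal ((norm (G x))\<^sup>2)
      + ennreal ((1 + 1 / d) / s\<^sup>2) * (indicator ?B x * ennreal ((1 - u x)\<^sup>2))"
      using G(2) AE_GDERIV_gradient[OF cutoff_lipschitz[OF s, of z \<rho>]]
    proof eventually_elim
      case (elim x)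
      let ?a = "gradient ?c x"
      have "GDERIV w x :> G x + (?c x *\<^sub>R (0 - G x) + (1 - u x) *\<^sub>R ?a)"
        unfolding w_def by (intro GDERIV_add GDERIV_mult GDERIV_diff GDERIV_const elim)
      then have grad: "gradient w x = (1 - ?c x) *\<^sub>R G x + (1 - u x) *\<^sub>R ?a"
        by (simp add: GDERIV_imp_gradient scaleR_diff_left)
      have "(norm (gradient w x))\<^sup>2 \<le> (1 + d) * (norm ((1 - ?c x) *\<^sub>R G x))\<^sup>2 + (1 + 1 / d) * (norm ((1 - u x) *\<^sub>R ?a))\<^sup>2"
        unfolding grad by (rule power2_norm_add_le[OF d])
      also have "\<dots> \<le> (1 + d) * (norm (G x))\<^sup>2 + (1 + 1 / d) * (indicator ?B x * (1 - u x)\<^sup>2 / s\<^sup>2)"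
      proof (intro add_mono mult_left_mono)
        show "(norm ((1 - ?c x) *\<^sub>R G x))\<^sup>2 \<le> (norm (G x))\<^sup>2"
          using cutoff_01[of z \<rho> s x] by (intro power_mono) (auto simp: mult_left_le_one_le)
        have "(norm ?a)\<^sup>2 \<le> (1 / s)\<^sup>2"
          using norm_gradient_cutoff(1)[OF s, of z \<rho> x] by (intro power_mono) auto
        then have "(1 - u x)\<^sup>2 * (norm ?a)\<^sup>2 \<le> (1 - u x)\<^sup>2 * (1 / s)\<^sup>2"
          by (intro mult_left_mono) auto
        then show "(norm ((1 - u x) *\<^sub>R ?a))\<^sup>2 \<le> indicator ?B x * (1 - u x)\<^sup>2 / s\<^sup>2"
          using norm_gradient_cutoff(2)[OF s, of x z \<rho>]
          by (cases "x \<in> ?B") (auto simp: power_mult_distrib power_divide)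
      qed (use d in auto)
      finally have "ennreal ((norm (gradient w x))\<^sup>2) \<le>
        ennreal ((1 + d) * (norm (G x))\<^sup>2 + (1 + 1 / d) * (indicator ?B x * (1 - u x)\<^sup>2 / s\<^sup>2))"
        by (rule ennreal_leI)
      also have "\<dots> = ennreal ((1 + d) * (norm (G x))\<^sup>2) + ennreal ((1 + 1 / d) / s\<^sup>2 * (indicator ?B x * (1 - u x)\<^sup>2))"
        using d by (subst ennreal_plus) (auto simp: mult_ac)
      also have "\<dots> = ennreal (1 + d) * ennreal ((norm (G x))\<^sup>2)
        + ennreal ((1 + 1 / d) / s\<^sup>2) * (indicator ?B x * ennreal ((1 - u x)\<^sup>2))"
        using d by (subst (1 2) ennreal_mult) (auto simp: indicator_def)
      finally show ?case .
    qed
  qed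
  also have "\<dots> = ennreal (1 + d) * dirichlet u
    + ennreal ((1 + 1 / d) / s\<^sup>2) * (\<integral>\<^sup>+ x. indicator ?B x * ennreal ((1 - u x)\<^sup>2) \<partial>lborel)"
    unfolding dirichlet_eq[OF G(2)] by (subst nn_integral_add) (auto simp: nn_integral_cmult)
  finally show ?thesis .
qed

section \<open>Scaling and translation of ball capacities\<close>

lemma GDERIV_affine:
  fixes w :: "'a::euclidean_space \<Rightarrow> real"
  assumes "GDERIV w (a + t *\<^sub>R z) :> D"
  shows "GDERIV (\<lambda>z. w (a + t *\<^sub>R z)) z :> t *\<^sub>R D"
proof -
  have "((\<lambda>z. a + t *\<^sub>R z) has_derivative (\<lambda>h. t *\<^sub>R h)) (at z)"
    by (auto intro!: derivative_eq_intros)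
  from has_derivative_compose[OF this assms[unfolded gderiv_def]]
  show ?thesis
    by (simp add: gderiv_def)
qed

text \<open>Competitors are pulled back along the affine map taking \<open>cball x R\<close> onto
  \<open>cball y (t * R)\<close>: the squared gradient gains \<open>t\<^sup>2\<close>, the volume
  element loses \<open>t ^ DIM('a)\<close>. Taking \<open>t = 1\<close> compares balls with
  different centres.\<close>

lemma wiener_capacity_cball_scale:
  fixes x y :: "'a::euclidean_space"
  assumes t: "0 < t" and n: "DIM('a) \<ge> 2"
  shows "ennreal (t ^ (DIM('a) - 2)) * wiener_capacity (cball x R) \<le> wiener_capacity (cball y (t * R))"
  unfolding wiener_capacity_eq[of "cball y (t * R)"]
proof (rule Inf_greatest, clarify)
  fix w :: "'a \<Rightarrow> real"
  assume w: "test_function w" and w1: "\<forall>x\<in>cball y (t * R). w x = 1"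
  obtain C where C: "C-lipschitz_on UNIV w"
    using w unfolding test_function_def by blast
  obtain G where G[measurable]: "G \<in> borel_measurable borel" "AE x in lborel. GDERIV w x :> G x"
    using rademacher[OF C] by blast
  obtain B where B: "\<And>x. w x \<noteq> 0 \<Longrightarrow> norm x \<le> B"
    using test_function_bounded_support[OF w] unfolding bounded_iff by auto
  define a where "a = y - t *\<^sub>R x"
  define v where "v = (\<lambda>z. w (a + t *\<^sub>R z))"
  have "test_function v"
  proof (rule test_functionI)
    show "(C * t)-lipschitz_on UNIV v"
    proof (rule lipschitz_onI)
      show "dist (v p) (v q) \<le> C * t * dist p q" for p q
        using lipschitz_onD[OF C, of "a + t *\<^sub>R p" "a + t *\<^sub>R q"] t
        by (simp add: v_def dist_norm scaleR_diff_right[symmetric] mult_ac)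
    qed (use t lipschitz_on_nonneg[OF C] in auto)
    show "z \<in> cball 0 ((B + norm a) / t)" if "v z \<noteq> 0" for z
    proof -
      have "norm (t *\<^sub>R z) \<le> norm (a + t *\<^sub>R z) + norm a"
        using norm_triangle_ineq4[of "a + t *\<^sub>R z" a] by simp
      also have "\<dots> \<le> B + norm a"
        using B[of "a + t *\<^sub>R z"] that by (simp add: v_def)
      finally show ?thesis
        using t by (simp add: field_simps)
    qed
  qed (rule bounded_cball)
  moreover have "v z = 1" if "z \<in> cball x R" for z
  proof -
    have "dist y (a + t *\<^sub>R z) = t * dist x z"
      using t by (simp add: a_def dist_norm scaleR_diff_right[symmetric] norm_minus_commute)
    then show ?thesis
      using that t w1 by (simp add: v_def)
  qed
  ultimately have "wiener_capacity (cball x R) \<le> dirichlet v"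
    by (rule wiener_capacity_le)
  also have "dirichlet v = (\<integral>\<^sup>+ z. ennreal ((norm (t *\<^sub>R G (a + t *\<^sub>R z)))\<^sup>2) \<partial>lborel)"
  proof (rule dirichlet_eq)
    have "AE z in lborel. GDERIV w (a + t *\<^sub>R z) :> G (a + t *\<^sub>R z)"
      using G(2) t by (intro AE_lborel_affine) auto
    then show "AE z in lborel. GDERIV v z :> t *\<^sub>R G (a + t *\<^sub>R z)"
      unfolding v_def by eventually_elim (rule GDERIV_affine)
  qed
  also have "\<dots> = ennreal (t\<^sup>2) * (\<integral>\<^sup>+ z. ennreal ((norm (G (a + t *\<^sub>R z)))\<^sup>2) \<partial>lborel)"
    by (subst nn_integral_cmult[symmetric]) (auto simp: power_mult_distrib ennreal_mult)
  finally have "ennreal (t ^ (DIM('a) - 2)) * wiener_capacity (cball x R)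
      \<le> ennreal (t ^ (DIM('a) - 2)) * (ennreal (t\<^sup>2) * (\<integral>\<^sup>+ z. ennreal ((norm (G (a + t *\<^sub>R z)))\<^sup>2) \<partial>lborel))"
    by (rule mult_left_mono) simp
  also have "\<dots> = ennreal (t ^ (DIM('a) - 2) * t\<^sup>2) * (\<integral>\<^sup>+ z. ennreal ((norm (G (a + t *\<^sub>R z)))\<^sup>2) \<partial>lborel)"
    using t by (subst ennreal_mult) (auto simp: mult.assoc)
  \<comment> \<open>The dimension bound makes the subtraction on naturals exact.\<close>
  also have "t ^ (DIM('a) - 2) * t\<^sup>2 = \<bar>t\<bar> ^ DIM('a)"
    using t le_add_diff_inverse2[OF n] by (simp only: power_add[symmetric] abs_of_pos)
  also have "ennreal (\<bar>t\<bar> ^ DIM('a)) * (\<integral>\<^sup>+ z. ennreal ((norm (G (a + t *\<^sub>R z)))\<^sup>2) \<partial>lborel) = dirichlet w"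
    unfolding dirichlet_eq[OF G(2)]
    using t by (intro nn_integral_lborel_affine[symmetric, of "\<lambda>x. ennreal ((norm (G x))\<^sup>2)"]) auto
  finally show "ennreal (t ^ (DIM('a) - 2)) * wiener_capacity (cball x R) \<le> dirichlet w" .
qed

section \<open>Choice of constants and conclusion\<close>

lemma uniform_capacity_density_improves:
  fixes F :: "'a::euclidean_space set"
  assumes n: "DIM('a) \<ge> 2" and r: "0 < r" and c: "0 < c"
    and F: "\<And>y. ennreal c \<le> wiener_capacity (F \<inter> cball y r)"
  shows "\<exists>R>0. \<forall>x. wiener_capacity (F \<inter> cball x R) \<ge> ennreal 0.99 * wiener_capacity (cball x R)"
proof -
  define V where "V = measure lborel (cball (0::'a) (2 * r))"
  have V: "emeasure lborel (cball (0::'a) (2 * r)) = ennreal V"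
    unfolding V_def using emeasure_bounded_finite[OF bounded_cball, of "0::'a" "2 * r"]
    by (intro emeasure_eq_ennreal_measure) auto
  have V0: "0 \<le> V"
    by (simp add: V_def)
  \<comment> \<open>The factor 1001 is \<open>1 + 1 / d\<close> for \<open>d = 1 / 1000\<close>, and
    \<open>10 * V / c\<close> is the constant of \<open>L2_le_dirichlet\<close>.\<close>
  define k where "k = 1001 * (10 * V / c)"
  have k: "0 \<le> k"
    using V0 c by (simp add: k_def)
  \<comment> \<open>The layer is wide enough for the cutoff to cost at most a thousandth of the
    Dirichlet integral; the summand 1 keeps \<open>s\<close> positive when
    \<open>k = 0\<close>.\<close>
  define s where "s = sqrt (1000 * k) + 1"
  have s: "0 < s" and ks: "k / s\<^sup>2 \<le> 1 / 1000"
  proof -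
    have "0 \<le> sqrt (1000 * k)"
      using k by simp
    then show s: "0 < s"
      unfolding s_def by linarith
    have "(sqrt (1000 * k))\<^sup>2 \<le> s\<^sup>2"
      using \<open>0 \<le> sqrt (1000 * k)\<close> by (intro power_mono) (auto simp: s_def)
    then have "1000 * k \<le> s\<^sup>2"
      using k by simp
    then show "k / s\<^sup>2 \<le> 1 / 1000"
      using s by (simp add: field_simps)
  qed
  define m where "m = DIM('a) - 2"
  \<comment> \<open>\<open>R\<close> is chosen so large that losing \<open>r + s\<close> shrinks it
    only by the factor \<open>t\<close>; by Bernoulli, \<open>t ^ m\<close> is then at least
    \<open>1 - m / (200 * (m + 1))\<close>, which exceeds 0.995.\<close>
  define R where "R = (r + s) * (200 * (real m + 1))"
  define t where "t = 1 - 1 / (200 * (real m + 1))"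
  have R: "0 < R"
    using r s by (simp add: R_def)
  have t: "0 < t"
    by (simp add: t_def)
  have tR: "t * R = R - r - s"
    by (simp add: t_def R_def field_simps)
  have tm: "0.995 \<le> t ^ m"
  proof -
    have "0.995 \<le> 1 + real m * (- (1 / (200 * (real m + 1))))"
      by (simp add: field_simps)
    also have "\<dots> \<le> (1 + (- (1 / (200 * (real m + 1))))) ^ m"
      by (rule Bernoulli_inequality) simp
    finally show ?thesis
      by (simp add: t_def)
  qed
  show ?thesis
  proof (intro exI[of _ R] conjI R allI)
    fix x :: 'a
    show "ennreal 0.99 * wiener_capacity (cball x R) \<le> wiener_capacity (F \<inter> cball x R)"
      unfolding wiener_capacity_eq[of "F \<inter> cball x R"]
    proof (rule Inf_greatest, clarify)
      fix u :: "'a \<Rightarrow> real"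
      assume u: "test_function u" and u1: "\<forall>z\<in>F \<inter> cball x R. u z = 1"
      \<comment> \<open>The radius is \<open>R - r\<close>, so balls of radius \<open>r\<close>
        about points of \<open>?A\<close> stay in \<open>cball x R\<close>. It is written to match
        \<open>\<rho> + s\<close> in \<open>wiener_capacity_cball_le\<close>.\<close>
      let ?A = "cball x (R - r - s + s)"
      let ?I = "\<integral>\<^sup>+ y. indicator ?A y * ennreal ((1 - u y)\<^sup>2) \<partial>lborel"
      have I: "ennreal c * ?I \<le> 10 * ennreal V * dirichlet u"
        unfolding V[symmetric]
      proof (rule L2_le_dirichlet[OF u r _ _ F])
        fix y z assume "y \<in> ?A" "z \<in> F \<inter> cball y r"
        moreover have "dist x z \<le> dist x y + dist y z"
          by (rule dist_triangle)
        ultimately show "u z = 1"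
          using u1 by auto
      qed simp
      have "ennreal (1001 / s\<^sup>2) * ?I = ennreal (1001 / s\<^sup>2 / c) * (ennreal c * ?I)"
        using c by (simp add: mult.assoc[symmetric] ennreal_mult'[symmetric])
      also have "\<dots> \<le> ennreal (1001 / s\<^sup>2 / c) * (10 * ennreal V * dirichlet u)"
        using I by (rule mult_left_mono) simp
      also have "\<dots> = ennreal (k / s\<^sup>2) * dirichlet u"
        using c V0 by (simp add: k_def mult.assoc[symmetric] ennreal_mult'[symmetric] mult.commute[of c] flip: ennreal_numeral)
      also have "\<dots> \<le> ennreal (1 / 1000) * dirichlet u"
        using ks by (intro mult_right_mono ennreal_leI) auto
      finally have I2: "ennreal (1001 / s\<^sup>2) * ?I \<le> ennreal (1 / 1000) * dirichlet u" .
      have "ennreal (t ^ m) * wiener_capacity (cball x R) \<le> wiener_capacity (cball x (R - r - s))"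
        using wiener_capacity_cball_scale[OF t n, of x R x] by (simp add: m_def tR)
      also have "\<dots> \<le> ennreal (1 + 1 / 1000) * dirichlet u + ennreal (1001 / s\<^sup>2) * ?I"
        using wiener_capacity_cball_le[OF u s, of "1 / 1000" x "R - r - s"] by simp
      also have "\<dots> \<le> ennreal (1 + 1 / 1000) * dirichlet u + ennreal (1 / 1000) * dirichlet u"
        by (intro add_left_mono I2)
      also have "\<dots> = ennreal 1.002 * dirichlet u"
        by (subst distrib_right[symmetric], subst ennreal_plus[symmetric]) auto
      finally have le: "ennreal (t ^ m) * wiener_capacity (cball x R) \<le> ennreal 1.002 * dirichlet u" .
      \<comment> \<open>Numerically, \<open>0.995 / 1.002\<close> is about 0.993.\<close>
      have "ennreal 0.99 * wiener_capacity (cball x R) \<le> ennreal (1 / 1.002 * t ^ m) * wiener_capacity (cball x R)"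
        using tm by (intro mult_right_mono ennreal_leI) auto
      also have "\<dots> = ennreal (1 / 1.002) * (ennreal (t ^ m) * wiener_capacity (cball x R))"
        using t by (subst ennreal_mult) (auto simp: mult.assoc)
      also have "\<dots> \<le> ennreal (1 / 1.002) * (ennreal 1.002 * dirichlet u)"
        using le by (rule mult_left_mono) simp
      also have "\<dots> = ennreal (1 / 1.002 * 1.002) * dirichlet u"
        by (subst ennreal_mult) (auto simp: mult.assoc)
      finally show "ennreal 0.99 * wiener_capacity (cball x R) \<le> dirichlet u"
        by simp
    qed
  qed
qed

theorem corollary1p4:
  fixes F :: "(real ^ 'n) set"
  assumes "CARD('n) \<ge> 3"
    and "closed F"
    and "\<exists>r>0. \<forall>x. wiener_capacity (F \<inter> cball x r) \<ge> ennreal 0.01 * wiener_capacity (cball x r)"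
  shows "\<exists>r\<^sub>1>0. \<forall>x. wiener_capacity (F \<inter> cball x r\<^sub>1) \<ge> ennreal 0.99 * wiener_capacity (cball x r\<^sub>1)"
proof -
  have n: "DIM(real ^ 'n) \<ge> 2"
    using assms(1) by simp
  obtain r where r: "r > 0"
    and F: "\<And>x. ennreal 0.01 * wiener_capacity (cball x r) \<le> wiener_capacity (F \<inter> cball x r)"
    using assms(3) by blast
  \<comment> \<open>Both directions together make the capacity independent of the centre, so the
    relative bound of the hypothesis becomes one absolute bound.\<close>
  have mono: "wiener_capacity (cball x r) \<le> wiener_capacity (cball y r)" for x y :: "real ^ 'n"
    using wiener_capacity_cball_scale[OF zero_less_one n, of x r y] by simp
  define \<kappa> where "\<kappa> = wiener_capacity (cball (0 :: real ^ 'n) r)"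
  show ?thesis
  proof (cases "\<kappa> = 0")
    case True
    then have "wiener_capacity (cball x r) = 0" for x :: "real ^ 'n"
      using mono[of x 0] by (simp add: \<kappa>_def)
    then show ?thesis
      using r by (intro exI[of _ r]) simp
  next
    case False
    \<comment> \<open>A value strictly below \<open>0.01 * \<kappa>\<close> is finite whether or not
      \<open>\<kappa>\<close> is, which provides the real constant \<open>c\<close>.\<close>
    then have "0 < ennreal 0.01 * \<kappa>"
      by (simp add: ennreal_zero_less_mult_iff zero_less_iff_neq_zero)
    then obtain z where z: "0 < z" "z < ennreal 0.01 * \<kappa>"
      using dense by blast
    then obtain c where c: "0 < ennreal c" "ennreal c < ennreal 0.01 * \<kappa>"
      by (cases z) auto
    have "ennreal c \<le> wiener_capacity (F \<inter> cball y r)" for y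
    proof -
      have "ennreal c \<le> ennreal 0.01 * wiener_capacity (cball y r)"
        using c(2) mult_left_mono[OF mono[of 0 y], of "ennreal 0.01"] by (auto simp: \<kappa>_def)
      with F[of y] show ?thesis by (rule order_trans[rotated])
    qed
    then show ?thesis
      using c(1) by (intro uniform_capacity_density_improves[OF n r, of c]) auto
  qed
qed

end
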